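(* Let $C$ be a cocommutative $k$-coalgebra and $\{\Psi_n:C\longrightarrow Vect_k(\mathscr O(n),\mathscr O'(n))\}_{n\ge0}$ a measuring of non-$\Sigma$ operads with multiplication. Let $\mathscr L$ and $\mathscr L'$ be cyclic unital comp modules over $\mathscr O$ and $\mathscr O'$ respectively. Then there exists a $(C,\{\Psi_n\}_{n\ge0})$-comodule measuring $\{\Theta_n:\mathcal Q_C(\mathscr L,\mathscr L')\longrightarrow Vect_k(\mathscr L(n),\mathscr L'(n))\}_{n\ge0}$ with the following universal property: for every $(C,\{\Psi_n\}_{n\ge0})$-comodule measuring $\{\Omega_n:D\longrightarrow Vect_k(\mathscr L(n),\mathscr L'(n))\}_{n\ge0}$, there exists a morphism $\chi:D\longrightarrow\mathcal Q_C(\mathscr L,\mathscr L')$ of $C$-comodules such that $\Theta_n\circ\chi=\Omega_n$ for each $n\ge0$.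
   Context: $k$ is a field; $Vect_k(V,W)$ denotes $k$-linear maps; Sweedler notation with summation suppressed. A non-$\Sigma$ operad $(\mathscr O,m,e)$ over $k$ with multiplication consists of vector spaces $\{\mathscr O(n)\}_{n\ge0}$, bilinear operations $\circ_i:\mathscr O(p)\otimes\mathscr O(q)\to\mathscr O(p+q-1)$ and an identity $\mathbf 1\in\mathscr O(1)$ such that for $u\in\mathscr O(p)$, $v\in\mathscr O(q)$, $w\in\mathscr O(r)$: $u\circ_iv=0$ if $p<i$ or $p=0$; $(u\circ_iv)\circ_jw$ equals $(u\circ_jw)\circ_{i+r-1}v$ if $j<i$, $u\circ_i(v\circ_{j-i+1}w)$ if $i\le j<q+i$, and $(u\circ_{j-q+1}w)\circ_iv$ if $j\ge q+i$; $u\circ_i\mathbf 1=\mathbf 1\circ_1u=u$ for $i\le p$; together with $m\in\mathscr O(2)$, $e\in\mathscr O(0)$ satisfying $m\circ_1m=m\circ_2m$ and $m\circ_1e=m\circ_2e=\mathbf 1$. A $C$-measuring from $(\mathscr O,m,e)$ to $(\mathscr O',m',e')$, with $C$ a cocommutative $k$-coalgebra with counit $\epsilon_C$, is a family of linear maps $\{\Psi_n:C\to Vect_k(\mathscr O(n),\mathscr O'(n))\}_{n\ge0}$ such that $\Psi_{p+q-1}(x)(u\circ_iv)=\Psi_p(x_{(1)})(u)\circ'_i\Psi_q(x_{(2)})(v)$, $\Psi_2(x)(m)=\epsilon_C(x)m'$, $\Psi_0(x)(e)=\epsilon_C(x)e'$ for all $x\in C$, $u\in\mathscr O(p)$, $v\in\mathscr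 O(q)$. A cyclic unital (left) comp module $\mathscr L$ over $(\mathscr O,m,e)$ consists of vector spaces $\{\mathscr L(n)\}_{n\ge0}$; bilinear operations $\bullet_i:\mathscr O(p)\otimes\mathscr L(n)\to\mathscr L(n-p+1)$, $0\le i\le n+1-p$, set to be zero for $p>n+1$, such that for $u\in\mathscr O(p)$, $v\in\mathscr O(q)$, $l\in\mathscr L(n)$: if $p>0$, $u\bullet_i(v\bullet_jl)$ equals $v\bullet_j(u\bullet_{i+q-1}l)$ if $j<i$, $(u\circ_{j-i+1}v)\bullet_il$ if $j-p<i\le j$, and $v\bullet_{j-p+1}(u\bullet_il)$ if $0\le i\le j-p$; if $p=0$, $u\bullet_i(v\bullet_jl)$ equals $v\bullet_j(u\bullet_{i+q-1}l)$ if $j<i$ and $v\bullet_{j+1}(u\bullet_il)$ if $0\le i\le j$; $\mathbf 1\bullet_il=l$ for $i=0,\dots,n$; and cyclic operators $t:\mathscr L(n)\to\mathscr L(n)$ ($n\ge1$; $t=\mathrm{id}$ on $\mathscr L(0)$) with $t(u\bullet_il)=u\bullet_{i+1}t(l)$ for $0\le i\le n-p$ and $t^{n+1}=\mathrm{id}$ on $\mathscr L(n)$. A $(C,\{\Psi_n\})$-comodule measuring from $\mathscr L$ to $\mathscr L'$ is a left $C$-comodule $D$ (coaction $y\mapsto y_{(0)}\otimes y_{(1)}\in C\otimes D$) and linear maps $\{\Omega_n:D\to Vect_k(\mathscr L(n),\mathscr L'(n))\}_{n\ge0}$ such that $\Omega_{n-p+1}(y)(u\bullet_il)=\Psi_p(y_{(0)})(u)\bullet_i\Omega_n(y_{(1)})(l)$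 for $u\in\mathscr O(p)$, $l\in\mathscr L(n)$, $0\le i\le n+1-p$, and $\Omega_n(y)(t(l))=t'(\Omega_n(y)(l))$. *)

theory Defs
  imports Complex_Main "HOL-Library.Function_Algebras"
begin

section \<open>Vector spaces with carrier\<close>

text \<open>A vector space is a subspace \<open>carr\<close> of some type carrying a vector space structure.
  The degrees of a graded vector space (a family indexed by \<open>nat\<close>) thus share one ambient type; as
  a direct sum can serve as the ambient type, this is no restriction on the family. The degrees may
  overlap inside the ambient type, so graded operations below take the degrees as arguments.\<close>

record ('k, 'v) vspace =
  carr :: "'v set"
  smul :: "'k \<Rightarrow> 'v \<Rightarrow> 'v"

definition is_vspace :: "('k::field, 'v::ab_group_add, 'z) vspace_scheme \<Rightarrow> bool" where
  "is_vspace V \<longleftrightarrow> vector_space (smul V) \<and> module.subspace (smul V) (carr V)"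

definition base_field :: "('k::field, 'k) vspace" where
  "base_field = \<lparr>carr = UNIV, smul = (*)\<rparr>"

definition k_linear ::
  "('k::field, 'v::ab_group_add, 'z) vspace_scheme \<Rightarrow> ('k, 'w::ab_group_add, 'y) vspace_scheme
    \<Rightarrow> ('v \<Rightarrow> 'w) \<Rightarrow> bool" where
  "k_linear V W f \<longleftrightarrow>
    (\<forall>x\<in>carr V. f x \<in> carr W) \<and>
    (\<forall>x\<in>carr V. \<forall>y\<in>carr V. f (x + y) = f x + f y) \<and>
    (\<forall>a. \<forall>x\<in>carr V. f (smul V a x) = smul W a (f x))"

definition k_bilinear ::
  "('k::field, 'u::ab_group_add, 'z) vspace_scheme \<Rightarrow> ('k, 'v::ab_group_add, 'y) vspace_scheme
    \<Rightarrow> ('k, 'w::ab_group_add, 'x) vspace_scheme \<Rightarrow> ('u \<Rightarrow> 'v \<Rightarrow> 'w) \<Rightarrow> bool" where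
  "k_bilinear U V W h \<longleftrightarrow>
    (\<forall>x\<in>carr U. k_linear V W (h x)) \<and> (\<forall>y\<in>carr V. k_linear U W (\<lambda>x. h x y))"

text \<open>\<open>Vect\<^sub>k(V,W)\<close>. Linear maps are normalised to vanish off \<open>carr V\<close>, so that equal maps
  are equal as HOL functions.\<close>

definition Vect ::
  "('k::field, 'v::ab_group_add, 'z) vspace_scheme \<Rightarrow> ('k, 'w::ab_group_add, 'y) vspace_scheme
    \<Rightarrow> ('k, 'v \<Rightarrow> 'w) vspace" where
  "Vect V W =
    \<lparr>carr = {f. k_linear V W f \<and> (\<forall>x. x \<notin> carr V \<longrightarrow> f x = 0)},
     smul = (\<lambda>a f x. smul W a (f x))\<rparr>"

section \<open>Tensor products\<close>

text \<open>Over a field, \<open>U \<otimes> V\<close> embeds into the dual of the space of bilinear forms on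
  \<open>U \<times> V\<close>, where \<open>x \<otimes> y\<close> is evaluation at \<open>(x, y)\<close>. We take this image as the definition of
  the tensor product; the universal property is proved below.\<close>

type_synonym ('k, 'u, 'v) tensor = "('u \<Rightarrow> 'v \<Rightarrow> 'k) \<Rightarrow> 'k"

definition tens ::
  "('k::field, 'u::ab_group_add, 'z) vspace_scheme \<Rightarrow> ('k, 'v::ab_group_add, 'y) vspace_scheme
    \<Rightarrow> 'u \<Rightarrow> 'v \<Rightarrow> ('k, 'u, 'v) tensor" where
  "tens U V x y = (\<lambda>\<beta>. if k_bilinear U V base_field \<beta> then \<beta> x y else 0)"

definition tensor_space ::
  "('k::field, 'u::ab_group_add, 'z) vspace_scheme \<Rightarrow> ('k, 'v::ab_group_add, 'y) vspace_scheme
    \<Rightarrow> ('k, ('k, 'u, 'v) tensor) vspace" where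
  "tensor_space U V =
    \<lparr>carr = module.span (\<lambda>a t \<beta>. a * t \<beta>) {tens U V x y |x y. x \<in> carr U \<and> y \<in> carr V},
     smul = (\<lambda>a t \<beta>. a * t \<beta>)\<rparr>"

text \<open>The linear map \<open>U \<otimes> V \<rightarrow> W\<close> induced by a bilinear map \<open>h\<close>. In Sweedler notation,
  \<open>tensor_lift U V W h t\<close> is \<open>h x\<^sub>1 x\<^sub>2\<close> (summation suppressed) for \<open>t = x\<^sub>1 \<otimes> x\<^sub>2\<close>.\<close>

definition tensor_lift ::
  "('k::field, 'u::ab_group_add, 'z) vspace_scheme \<Rightarrow> ('k, 'v::ab_group_add, 'y) vspace_scheme
    \<Rightarrow> ('k, 'w::ab_group_add, 'x) vspace_scheme \<Rightarrow> ('u \<Rightarrow> 'v \<Rightarrow> 'w)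
    \<Rightarrow> ('k, 'u, 'v) tensor \<Rightarrow> 'w" where
  "tensor_lift U V W h =
    (THE f. f \<in> carr (Vect (tensor_space U V) W) \<and>
       (\<forall>x\<in>carr U. \<forall>y\<in>carr V. f (tens U V x y) = h x y))"

definition tensor_map ::
  "('k::field, 'u::ab_group_add, 'z) vspace_scheme \<Rightarrow> ('k, 'v::ab_group_add, 'y) vspace_scheme
    \<Rightarrow> ('k, 'u'::ab_group_add, 'x) vspace_scheme \<Rightarrow> ('k, 'v'::ab_group_add, 'w) vspace_scheme
    \<Rightarrow> ('u \<Rightarrow> 'u') \<Rightarrow> ('v \<Rightarrow> 'v') \<Rightarrow> ('k, 'u, 'v) tensor \<Rightarrow> ('k, 'u', 'v') tensor" where
  "tensor_map U V U' V' f g =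
    tensor_lift U V (tensor_space U' V') (\<lambda>x y. tens U' V' (f x) (g y))"

definition tensor_flip ::
  "('k::field, 'u::ab_group_add, 'z) vspace_scheme \<Rightarrow> ('k, 'v::ab_group_add, 'y) vspace_scheme
    \<Rightarrow> ('k, 'u, 'v) tensor \<Rightarrow> ('k, 'v, 'u) tensor" where
  "tensor_flip U V = tensor_lift U V (tensor_space V U) (\<lambda>x y. tens V U y x)"

definition tensor_assoc ::
  "('k::field, 'u::ab_group_add, 'z) vspace_scheme \<Rightarrow> ('k, 'v::ab_group_add, 'y) vspace_scheme
    \<Rightarrow> ('k, 'w::ab_group_add, 'x) vspace_scheme
    \<Rightarrow> ('k, ('k, 'u, 'v) tensor, 'w) tensor \<Rightarrow> ('k, 'u, ('k, 'v, 'w) tensor) tensor" where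
  "tensor_assoc U V W =
    tensor_lift (tensor_space U V) W (tensor_space U (tensor_space V W))
      (\<lambda>t z. tensor_lift U V (tensor_space U (tensor_space V W))
        (\<lambda>x y. tens U (tensor_space V W) x (tens V W y z)) t)"

lemma vector_space_tensor: "vector_space (\<lambda>(a::'k::field) (t::'i \<Rightarrow> 'k) \<beta>. a * t \<beta>)"
  by unfold_locales (auto simp: fun_eq_iff algebra_simps)

lemma is_vspace_base_field: "is_vspace base_field"
proof -
  interpret vector_space "(*) :: 'a::field \<Rightarrow> 'a \<Rightarrow> 'a"
    by unfold_locales (auto simp: algebra_simps)
  show ?thesis
    by (simp add: is_vspace_def base_field_def vector_space_axioms)
qed

lemma is_vspace_tensor_space: "is_vspace (tensor_space U V)"
proof -
  interpret vector_space "\<lambda>(a::'k::field) (t::('k,'u,'v) tensor) \<beta>. a * t \<beta>"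
    by (rule vector_space_tensor)
  show ?thesis
    by (simp add: is_vspace_def tensor_space_def vector_space_axioms)
qed

lemma k_bilinear_tens:
  fixes U :: "('k::field, 'u::ab_group_add, 'z) vspace_scheme"
    and V :: "('k, 'v::ab_group_add, 'y) vspace_scheme"
  shows "k_bilinear U V (tensor_space U V) (tens U V)"
proof -
  interpret vector_space "\<lambda>(a::'k) (t::('k,'u,'v) tensor) \<beta>. a * t \<beta>"
    by (rule vector_space_tensor)
  have "tens U V x y \<in> carr (tensor_space U V)" if "x \<in> carr U" "y \<in> carr V" for x y
    using that by (auto simp: tensor_space_def intro: span_base)
  then show ?thesis
    by (auto simp: k_bilinear_def k_linear_def tens_def tensor_space_def base_field_def fun_eq_iff)
qed

theorem tensor_universal_property:
  fixes U :: "('k::field, 'u::ab_group_add, 'z) vspace_scheme"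
    and V :: "('k, 'v::ab_group_add, 'y) vspace_scheme"
    and W :: "('k, 'w::ab_group_add, 'x) vspace_scheme"
  assumes W: "is_vspace W" and h: "k_bilinear U V W h"
  shows "\<exists>!f. f \<in> carr (Vect (tensor_space U V) W) \<and>
    (\<forall>x\<in>carr U. \<forall>y\<in>carr V. f (tens U V x y) = h x y)"
proof -
  let ?s = "\<lambda>(a::'k) (t::('k,'u,'v) tensor) \<beta>. a * t \<beta>"
  let ?P = "{tens U V x y |x y. x \<in> carr U \<and> y \<in> carr V}"
  let ?T = "tensor_space U V"
  interpret T: vector_space ?s
    by (rule vector_space_tensor)
  interpret W: vector_space "smul W"
    using W by (simp add: is_vspace_def)
  interpret K: vector_space "(*) :: 'k \<Rightarrow> 'k \<Rightarrow> 'k"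
    by unfold_locales (auto simp: algebra_simps)
  interpret TW: vector_space_pair ?s "smul W" ..
  interpret WK: vector_space_pair "smul W" "(*) :: 'k \<Rightarrow> 'k \<Rightarrow> 'k" ..
  interpret TK: vector_space_pair ?s "(*) :: 'k \<Rightarrow> 'k \<Rightarrow> 'k" ..
  have subW: "W.subspace (carr W)"
    using W by (simp add: is_vspace_def)
  have carrT: "carr ?T = T.span ?P" and smulT: "smul ?T = ?s"
    by (simp_all add: tensor_space_def)
  obtain B where B: "B \<subseteq> ?P" "T.independent B" "?P \<subseteq> T.span B"
    using T.maximal_independent_subset[of ?P] by blast
  have spanB: "T.span B = T.span ?P"
    using B by (metis (no_types, lifting) T.span_mono T.span_span subset_antisym)
  have "\<forall>b\<in>B. \<exists>p. fst p \<in> carr U \<and> snd p \<in> carr V \<and> b = tens U V (fst p) (snd p)"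
    using B(1) by force
  then obtain r where r: "\<And>b. b \<in> B \<Longrightarrow> fst (r b) \<in> carr U" "\<And>b. b \<in> B \<Longrightarrow> snd (r b) \<in> carr V"
    "\<And>b. b \<in> B \<Longrightarrow> b = tens U V (fst (r b)) (snd (r b))"
    by metis
  obtain g where g: "Vector_Spaces.linear ?s (smul W) g"
    "\<And>b. b \<in> B \<Longrightarrow> g b = h (fst (r b)) (snd (r b))"
    using TW.linear_independent_extend[OF B(2), of "\<lambda>b. h (fst (r b)) (snd (r b))"] by blast
  interpret g: Vector_Spaces.linear ?s "smul W" g
    by (rule g)
  have g_carr: "g t \<in> carr W" if "t \<in> carr ?T" for t
  proof -
    have "g ` B \<subseteq> carr W"
      using g(2) r h by (auto simp: k_bilinear_def k_linear_def)
    then have "W.span (g ` B) \<subseteq> carr W"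
      using subW by (rule W.span_minimal)
    moreover have "g t \<in> W.span (g ` B)"
      using that carrT spanB g.span_image[of B] by blast
    ultimately show ?thesis by blast
  qed
  have g_tens: "g (tens U V x y) = h x y" if xy: "x \<in> carr U" "y \<in> carr V" for x y
  proof (rule ccontr)
    assume ne: "g (tens U V x y) \<noteq> h x y"
    define w where "w = g (tens U V x y) - h x y"
    have "W.independent {w}"
      using ne by (simp add: w_def)
    then obtain \<phi> where \<phi>: "Vector_Spaces.linear (smul W) (*) \<phi>" "\<phi> w = (1::'k)"
      using WK.linear_independent_extend[of "{w}" "\<lambda>_. 1"] by blast
    interpret \<phi>: Vector_Spaces.linear "smul W" "(*)" \<phi>
      by (rule \<phi>)
    define \<beta> where "\<beta> = (\<lambda>x y. \<phi> (h x y))"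
    have \<beta>: "k_bilinear U V base_field \<beta>"
      using h by (auto simp: \<beta>_def k_bilinear_def k_linear_def base_field_def \<phi>.add \<phi>.scale)
    have lin1: "Vector_Spaces.linear ?s (*) (\<lambda>t. \<phi> (g t))"
      by unfold_locales (simp_all add: g.add g.scale \<phi>.add \<phi>.scale)
    have lin2: "Vector_Spaces.linear ?s (*) (\<lambda>t. t \<beta>)"
      by unfold_locales simp_all
    have "\<phi> (g b) = b \<beta>" if "b \<in> B" for b
      using g(2)[OF that] r(3)[OF that] \<beta> by (metis \<beta>_def tens_def)
    moreover have "tens U V x y \<in> T.span B"
      using B(3) xy by blast
    ultimately have "\<phi> (g (tens U V x y)) = tens U V x y \<beta>"
      using TK.linear_eq_on[OF lin1 lin2] by blast
    also have "\<dots> = \<phi> (h x y)"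
      using \<beta> by (simp add: tens_def \<beta>_def)
    finally have "\<phi> w = 0"
      by (simp add: w_def \<phi>.diff)
    with \<phi>(2) show False by simp
  qed
  define f where "f = (\<lambda>t. if t \<in> carr ?T then g t else 0)"
  have tens_in: "tens U V x y \<in> carr ?T" if "x \<in> carr U" "y \<in> carr V" for x y
    using that by (auto simp: carrT intro: T.span_base)
  show ?thesis
  proof (rule ex1I[of _ f])
    have "k_linear ?T W f"
      unfolding k_linear_def smulT
      using g_carr by (auto simp: f_def carrT g.add g.scale T.span_add T.span_scale)
    then show "f \<in> carr (Vect ?T W) \<and> (\<forall>x\<in>carr U. \<forall>y\<in>carr V. f (tens U V x y) = h x y)"
      using g_tens tens_in by (simp add: Vect_def f_def)
  next
    fix f' assume f': "f' \<in> carr (Vect ?T W) \<and> (\<forall>x\<in>carr U. \<forall>y\<in>carr V. f' (tens U V x y) = h x y)"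
    then have lin: "k_linear ?T W f'" and off: "\<And>t. t \<notin> carr ?T \<Longrightarrow> f' t = 0"
      by (auto simp: Vect_def)
    have "t \<in> carr ?T \<and> f' t = g t" if "t \<in> T.span ?P" for t
      using that
    proof (induction rule: T.span_induct_alt)
      case base
      have z: "(0::('k,'u,'v) tensor) \<in> carr ?T"
        by (simp add: carrT T.span_zero)
      then have "f' (?s 0 0) = smul W 0 (f' 0)"
        using lin unfolding k_linear_def smulT by blast
      moreover have "?s 0 0 = 0"
        by (rule T.scale_zero_left)
      ultimately show ?case
        using z by simp
    next
      case (step c x y)
      then have x: "x \<in> carr ?T"
        by (metis (no_types, lifting) T.span_base carrT)
      then have cx: "?s c x \<in> carr ?T"
        by (simp add: carrT T.span_scale)
      have y: "y \<in> carr ?T" "f' y = g y"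
        using step by auto
      have "f' (?s c x + y) = smul W c (f' x) + f' y"
        using lin cx y x unfolding k_linear_def smulT by metis
      also have "f' x = g x"
        using step(1) f' g_tens by auto
      also have "smul W c (g x) + f' y = g (?s c x + y)"
        unfolding y(2) g.add[of "?s c x" y] g.scale[of c x] ..
      finally show ?case
        using T.span_add[of "?s c x" ?P y] cx y carrT by metis
    qed
    then show "f' = f"
      using off by (auto simp: f_def carrT fun_eq_iff)
  qed
qed

section \<open>Coalgebras and comodules\<close>

record ('k, 'c) coalgebra = "('k, 'c) vspace" +
  comult :: "'c \<Rightarrow> ('k, 'c, 'c) tensor"
  counit :: "'c \<Rightarrow> 'k"

definition is_coalgebra :: "('k::field, 'c::ab_group_add, 'z) coalgebra_scheme \<Rightarrow> bool" where
  "is_coalgebra C \<longleftrightarrow>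
    is_vspace C \<and>
    k_linear C (tensor_space C C) (comult C) \<and>
    k_linear C base_field (counit C) \<and>
    (\<forall>x\<in>carr C.
      tensor_assoc C C C (tensor_map C C (tensor_space C C) C (comult C) (\<lambda>z. z) (comult C x)) =
      tensor_map C C C (tensor_space C C) (\<lambda>z. z) (comult C) (comult C x)) \<and>
    (\<forall>x\<in>carr C. tensor_lift C C C (\<lambda>a b. smul C (counit C a) b) (comult C x) = x) \<and>
    (\<forall>x\<in>carr C. tensor_lift C C C (\<lambda>a b. smul C (counit C b) a) (comult C x) = x)"

definition is_cocommutative :: "('k::field, 'c::ab_group_add, 'z) coalgebra_scheme \<Rightarrow> bool" where
  "is_cocommutative C \<longleftrightarrow> (\<forall>x\<in>carr C. tensor_flip C C (comult C x) = comult C x)"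

record ('k, 'c, 'd) comodule = "('k, 'd) vspace" +
  coact :: "'d \<Rightarrow> ('k, 'c, 'd) tensor"

definition is_comodule ::
  "('k::field, 'c::ab_group_add, 'z) coalgebra_scheme
    \<Rightarrow> ('k, 'c, 'd::ab_group_add, 'y) comodule_scheme \<Rightarrow> bool" where
  "is_comodule C D \<longleftrightarrow>
    is_vspace D \<and>
    k_linear D (tensor_space C D) (coact D) \<and>
    (\<forall>y\<in>carr D.
      tensor_assoc C C D (tensor_map C D (tensor_space C C) D (comult C) (\<lambda>z. z) (coact D y)) =
      tensor_map C D C (tensor_space C D) (\<lambda>z. z) (coact D) (coact D y)) \<and>
    (\<forall>y\<in>carr D. tensor_lift C D D (\<lambda>a z. smul D (counit C a) z) (coact D y) = y)"

definition comodule_morphism ::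
  "('k::field, 'c::ab_group_add, 'z) coalgebra_scheme
    \<Rightarrow> ('k, 'c, 'd::ab_group_add, 'y) comodule_scheme
    \<Rightarrow> ('k, 'c, 'e::ab_group_add, 'x) comodule_scheme \<Rightarrow> ('d \<Rightarrow> 'e) \<Rightarrow> bool" where
  "comodule_morphism C D E \<chi> \<longleftrightarrow>
    k_linear D E \<chi> \<and>
    (\<forall>y\<in>carr D. coact E (\<chi> y) = tensor_map C D C E (\<lambda>a. a) \<chi> (coact D y))"

section \<open>Operads with multiplication and cyclic unital comp modules\<close>

text \<open>\<open>ocomp P p q i u v\<close> is \<open>u \<circ>\<^sub>i v\<close> for \<open>u \<in> O(p)\<close>, \<open>v \<in> O(q)\<close>, with \<open>i \<ge> 1\<close>. The
  natural-number subtraction in the degree \<open>p + q - 1\<close> truncates only for \<open>p = q = 0\<close>, where the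
  operation is zero anyway.\<close>

record ('k, 'o) operad =
  ospace :: "nat \<Rightarrow> ('k, 'o) vspace"
  ocomp :: "nat \<Rightarrow> nat \<Rightarrow> nat \<Rightarrow> 'o \<Rightarrow> 'o \<Rightarrow> 'o"
  ident :: 'o
  omult :: 'o
  ounit :: 'o

definition is_operad_with_mult :: "('k::field, 'o::ab_group_add) operad \<Rightarrow> bool" where
  "is_operad_with_mult P \<longleftrightarrow>
    (\<forall>n. is_vspace (ospace P n)) \<and>
    (\<forall>p q i. 1 \<le> i \<longrightarrow>
      k_bilinear (ospace P p) (ospace P q) (ospace P (p + q - 1)) (ocomp P p q i)) \<and>
    (\<forall>p q i. \<forall>u\<in>carr (ospace P p). \<forall>v\<in>carr (ospace P q).
      1 \<le> i \<and> (p < i \<or> p = 0) \<longrightarrow> ocomp P p q i u v = 0) \<and>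
    (\<forall>p q r i j. \<forall>u\<in>carr (ospace P p). \<forall>v\<in>carr (ospace P q). \<forall>w\<in>carr (ospace P r).
      1 \<le> i \<and> 1 \<le> j \<longrightarrow>
      ocomp P (p + q - 1) r j (ocomp P p q i u v) w =
        (if j < i then ocomp P (p + r - 1) q (i + r - 1) (ocomp P p r j u w) v
         else if j < q + i then ocomp P p (q + r - 1) i u (ocomp P q r (j - i + 1) v w)
         else ocomp P (p + r - 1) q i (ocomp P p r (j - q + 1) u w) v)) \<and>
    ident P \<in> carr (ospace P 1) \<and>
    (\<forall>p. \<forall>u\<in>carr (ospace P p). ocomp P 1 p 1 (ident P) u = u) \<and>
    (\<forall>p i. \<forall>u\<in>carr (ospace P p). 1 \<le> i \<and> i \<le> p \<longrightarrow> ocomp P p 1 i u (ident P) = u) \<and>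
    omult P \<in> carr (ospace P 2) \<and>
    ounit P \<in> carr (ospace P 0) \<and>
    ocomp P 2 2 1 (omult P) (omult P) = ocomp P 2 2 2 (omult P) (omult P) \<and>
    ocomp P 2 0 1 (omult P) (ounit P) = ident P \<and>
    ocomp P 2 0 2 (omult P) (ounit P) = ident P"

text \<open>\<open>lact L p n i u l\<close> is \<open>u \<bullet>\<^sub>i l \<in> L(n - p + 1)\<close> for \<open>u \<in> O(p)\<close>, \<open>l \<in> L(n)\<close>; it carries content
  only for \<open>p \<le> n + 1\<close> and \<open>i \<le> n + 1 - p\<close>. The axioms below are stated for those indices for
  which both sides are composed of such operations.\<close>

record ('k, 'o, 'l) comp_module =
  lspace :: "nat \<Rightarrow> ('k, 'l) vspace"
  lact :: "nat \<Rightarrow> nat \<Rightarrow> nat \<Rightarrow> 'o \<Rightarrow> 'l \<Rightarrow> 'l"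
  lcyc :: "nat \<Rightarrow> 'l \<Rightarrow> 'l"

definition is_cyclic_comp_module ::
  "('k::field, 'o::ab_group_add) operad \<Rightarrow> ('k, 'o, 'l::ab_group_add) comp_module \<Rightarrow> bool" where
  "is_cyclic_comp_module P L \<longleftrightarrow>
    (\<forall>n. is_vspace (lspace L n)) \<and>
    (\<forall>p n i. p \<le> n + 1 \<and> i \<le> n + 1 - p \<longrightarrow>
      k_bilinear (ospace P p) (lspace L n) (lspace L (n + 1 - p)) (lact L p n i)) \<and>
    (\<forall>p n i. \<forall>u\<in>carr (ospace P p). \<forall>l\<in>carr (lspace L n).
      n + 1 < p \<longrightarrow> lact L p n i u l = 0) \<and>
    (\<forall>p q n i j. \<forall>u\<in>carr (ospace P p). \<forall>v\<in>carr (ospace P q). \<forall>l\<in>carr (lspace L n).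
      0 < p \<and> q + j \<le> n + 1 \<and> p + i \<le> (n + 1 - q) + 1 \<longrightarrow>
      lact L p (n + 1 - q) i u (lact L q n j v l) =
        (if j < i then lact L q (n + 1 - p) j v (lact L p n (i + q - 1) u l)
         else if j < i + p then lact L (p + q - 1) n i (ocomp P p q (j - i + 1) u v) l
         else lact L q (n + 1 - p) (j - p + 1) v (lact L p n i u l))) \<and>
    (\<forall>q n i j. \<forall>u\<in>carr (ospace P 0). \<forall>v\<in>carr (ospace P q). \<forall>l\<in>carr (lspace L n).
      q + j \<le> n + 1 \<and> i \<le> (n + 1 - q) + 1 \<longrightarrow>
      lact L 0 (n + 1 - q) i u (lact L q n j v l) =
        (if j < i then lact L q (n + 1) j v (lact L 0 n (i + q - 1) u l)
         else lact L q (n + 1) (j + 1) v (lact L 0 n i u l))) \<and>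
    (\<forall>n i. \<forall>l\<in>carr (lspace L n). i \<le> n \<longrightarrow> lact L 1 n i (ident P) l = l) \<and>
    (\<forall>n. k_linear (lspace L n) (lspace L n) (lcyc L n)) \<and>
    (\<forall>l\<in>carr (lspace L 0). lcyc L 0 l = l) \<and>
    (\<forall>p n i. \<forall>u\<in>carr (ospace P p). \<forall>l\<in>carr (lspace L n).
      p \<le> n \<and> i \<le> n - p \<longrightarrow>
      lcyc L (n + 1 - p) (lact L p n i u l) = lact L p n (i + 1) u (lcyc L n l)) \<and>
    (\<forall>n. \<forall>l\<in>carr (lspace L n). (lcyc L n ^^ (n + 1)) l = l)"

section \<open>Measurings\<close>

definition is_measuring ::
  "('k::field, 'c::ab_group_add) coalgebra \<Rightarrow> ('k, 'o::ab_group_add) operad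
    \<Rightarrow> ('k, 'p::ab_group_add) operad \<Rightarrow> (nat \<Rightarrow> 'c \<Rightarrow> 'o \<Rightarrow> 'p) \<Rightarrow> bool" where
  "is_measuring C P P' \<Psi> \<longleftrightarrow>
    (\<forall>n. k_linear C (Vect (ospace P n) (ospace P' n)) (\<Psi> n)) \<and>
    (\<forall>p q i. \<forall>x\<in>carr C. \<forall>u\<in>carr (ospace P p). \<forall>v\<in>carr (ospace P q). 1 \<le> i \<longrightarrow>
      \<Psi> (p + q - 1) x (ocomp P p q i u v) =
        tensor_lift C C (ospace P' (p + q - 1))
          (\<lambda>x\<^sub>1 x\<^sub>2. ocomp P' p q i (\<Psi> p x\<^sub>1 u) (\<Psi> q x\<^sub>2 v)) (comult C x)) \<and>
    (\<forall>x\<in>carr C. \<Psi> 2 x (omult P) = smul (ospace P' 2) (counit C x) (omult P')) \<and>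
    (\<forall>x\<in>carr C. \<Psi> 0 x (ounit P) = smul (ospace P' 0) (counit C x) (ounit P'))"

definition is_comodule_measuring ::
  "('k::field, 'c::ab_group_add) coalgebra \<Rightarrow> ('k, 'o::ab_group_add) operad
    \<Rightarrow> (nat \<Rightarrow> 'c \<Rightarrow> 'o \<Rightarrow> 'p::ab_group_add)
    \<Rightarrow> ('k, 'o, 'l::ab_group_add) comp_module \<Rightarrow> ('k, 'p, 'm::ab_group_add) comp_module
    \<Rightarrow> ('k, 'c, 'd::ab_group_add) comodule \<Rightarrow> (nat \<Rightarrow> 'd \<Rightarrow> 'l \<Rightarrow> 'm) \<Rightarrow> bool" where
  "is_comodule_measuring C P \<Psi> L L' D \<Omega> \<longleftrightarrow>
    is_comodule C D \<and>
    (\<forall>n. k_linear D (Vect (lspace L n) (lspace L' n)) (\<Omega> n)) \<and>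
    (\<forall>p n i. \<forall>y\<in>carr D. \<forall>u\<in>carr (ospace P p). \<forall>l\<in>carr (lspace L n).
      p \<le> n + 1 \<and> i \<le> n + 1 - p \<longrightarrow>
      \<Omega> (n + 1 - p) y (lact L p n i u l) =
        tensor_lift C D (lspace L' (n + 1 - p))
          (\<lambda>y\<^sub>0 y\<^sub>1. lact L' p n i (\<Psi> p y\<^sub>0 u) (\<Omega> n y\<^sub>1 l)) (coact D y)) \<and>
    (\<forall>n. \<forall>y\<in>carr D. \<forall>l\<in>carr (lspace L n). \<Omega> n y (lcyc L n l) = lcyc L' n (\<Omega> n y l))"

section \<open>The universal measuring comodule\<close>

definition hom_product ::
  "('k::field, 'o, 'l::ab_group_add) comp_module \<Rightarrow> ('k, 'p, 'm::ab_group_add) comp_module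
    \<Rightarrow> ('k, nat \<Rightarrow> 'l \<Rightarrow> 'm) vspace" where
  "hom_product L L' =
    \<lparr>carr = {f. \<forall>n. f n \<in> carr (Vect (lspace L n) (lspace L' n))},
     smul = (\<lambda>a f n. smul (Vect (lspace L n) (lspace L' n)) a (f n))\<rparr>"

definition cofree_comodule ::
  "('k::field, 'c::ab_group_add) coalgebra \<Rightarrow> ('k, 'v::ab_group_add) vspace
    \<Rightarrow> ('k, 'c, ('k, 'c, 'v) tensor) comodule" where
  "cofree_comodule C V =
    \<lparr>carr = carr (tensor_space C V), smul = smul (tensor_space C V),
     coact = (\<lambda>t. tensor_assoc C C V
       (tensor_map C V (tensor_space C C) V (comult C) (\<lambda>z. z) t))\<rparr>"

definition cofree_proj ::
  "('k::field, 'c::ab_group_add) coalgebra \<Rightarrow> ('k, 'v::ab_group_add) vspace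
    \<Rightarrow> ('k, 'c, 'v) tensor \<Rightarrow> 'v" where
  "cofree_proj C V = tensor_lift C V V (\<lambda>a z. smul V (counit C a) z)"

definition is_subcomodule ::
  "('k::field, 'c::ab_group_add) coalgebra \<Rightarrow> ('k, 'c, 'd::ab_group_add) comodule
    \<Rightarrow> ('k, 'c, 'd) comodule \<Rightarrow> bool" where
  "is_subcomodule C E F \<longleftrightarrow>
    is_comodule C E \<and> carr E \<subseteq> carr F \<and> smul E = smul F \<and> comodule_morphism C E F (\<lambda>y. y)"

text \<open>The universal comodule \<open>Q\<^sub>C(L,L')\<close> is the sum of all subcomodules of the cofree comodule on
  \<open>\<Prod>\<^sub>n Vect\<^sub>k(L(n),L'(n))\<close> on which the components
  \<open>univ_measuring\<close> of the projection form a comodule measuring; these are also the maps \<open>\<Theta>\<^sub>n\<close>.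
  It is given by a construction because the universal property refers to comodules on arbitrary
  types, and such a quantifier over types cannot be put in the scope of an existential quantifier.
  The coaction is the one that makes the inclusion into the cofree comodule a morphism.\<close>

definition univ_measuring ::
  "('k::field, 'c::ab_group_add) coalgebra
    \<Rightarrow> ('k, 'o, 'l::ab_group_add) comp_module \<Rightarrow> ('k, 'p, 'm::ab_group_add) comp_module
    \<Rightarrow> nat \<Rightarrow> ('k, 'c, nat \<Rightarrow> 'l \<Rightarrow> 'm) tensor \<Rightarrow> 'l \<Rightarrow> 'm" where
  "univ_measuring C L L' n t = cofree_proj C (hom_product L L') t n"

definition univ_space ::
  "('k::field, 'c::ab_group_add) coalgebra \<Rightarrow> ('k, 'o::ab_group_add) operad
    \<Rightarrow> (nat \<Rightarrow> 'c \<Rightarrow> 'o \<Rightarrow> 'p::ab_group_add)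
    \<Rightarrow> ('k, 'o, 'l::ab_group_add) comp_module \<Rightarrow> ('k, 'p, 'm::ab_group_add) comp_module
    \<Rightarrow> ('k, ('k, 'c, nat \<Rightarrow> 'l \<Rightarrow> 'm) tensor) vspace" where
  "univ_space C P \<Psi> L L' =
    (let F = cofree_comodule C (hom_product L L') in
     \<lparr>carr = module.span (smul F)
        (\<Union>{carr E |E. is_subcomodule C E F \<and>
          is_comodule_measuring C P \<Psi> L L' E (univ_measuring C L L')}),
      smul = smul F\<rparr>)"

definition univ_comodule ::
  "('k::field, 'c::ab_group_add) coalgebra \<Rightarrow> ('k, 'o::ab_group_add) operad
    \<Rightarrow> (nat \<Rightarrow> 'c \<Rightarrow> 'o \<Rightarrow> 'p::ab_group_add)
    \<Rightarrow> ('k, 'o, 'l::ab_group_add) comp_module \<Rightarrow> ('k, 'p, 'm::ab_group_add) comp_module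
    \<Rightarrow> ('k, 'c, ('k, 'c, nat \<Rightarrow> 'l \<Rightarrow> 'm) tensor) comodule" where
  "univ_comodule C P \<Psi> L L' =
    (let F = cofree_comodule C (hom_product L L'); Q = univ_space C P \<Psi> L L' in
     \<lparr>carr = carr Q, smul = smul Q,
      coact = (\<lambda>t. THE z. z \<in> carr (tensor_space C Q) \<and>
        tensor_map C Q C F (\<lambda>a. a) (\<lambda>y. y) z = coact F t)\<rparr>)"

end

theory Submission
  imports Defs
begin

text \<open>An element of \<open>U \<otimes> V\<close> is a functional on bilinear forms, so equations between tensors can be
  tested against bilinear forms, which turns Sweedler notation into nested evaluations. In particular
  coassociativity becomes a scalar identity that passes to a subcomodule \<open>E\<close> of \<open>F\<close> along a linear
  retraction \<open>F \<rightarrow> E\<close>; over a field such a retraction exists, and it also makes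
  \<open>C \<otimes> E \<rightarrow> C \<otimes> F\<close> injective.

  A comodule measuring \<open>\<Omega>\<close> on \<open>D\<close> is a linear map from \<open>D\<close> to the product of the spaces
  \<open>Vect\<^sub>k(L(n),L'(n))\<close>, hence corresponds to the comodule morphism \<open>y \<mapsto> y\<^sub>0 \<otimes> \<Omega> y\<^sub>1\<close> into the cofree
  comodule. Its image is a subcomodule on which the projection is a comodule measuring, because the
  measuring equations are transported along comodule morphisms; so the image lies in the sum of
  all such subcomodules. These equations are linear in the element of the comodule, so they hold on
  the sum as well.\<close>

section \<open>Linear and bilinear maps\<close>

lemma
  assumes "is_vspace V"
  shows is_vspace_add: "x \<in> carr V \<Longrightarrow> y \<in> carr V \<Longrightarrow> x + y \<in> carr V"
    and is_vspace_scale: "x \<in> carr V \<Longrightarrow> smul V a x \<in> carr V"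
    and is_vspace_zero: "0 \<in> carr V"
proof -
  interpret vector_space "smul V"
    using assms by (simp add: is_vspace_def)
  have "subspace (carr V)"
    using assms by (simp add: is_vspace_def)
  then show "x \<in> carr V \<Longrightarrow> y \<in> carr V \<Longrightarrow> x + y \<in> carr V"
    "x \<in> carr V \<Longrightarrow> smul V a x \<in> carr V" "0 \<in> carr V"
    by (auto intro: subspace_add subspace_scale subspace_0)
qed

lemma
  assumes "is_vspace V"
  shows smul_add_right: "smul V a (x + y) = smul V a x + smul V a y"
    and smul_add_left: "smul V (a + b) x = smul V a x + smul V b x"
    and smul_smul: "smul V a (smul V b x) = smul V (a * b) x"
    and smul_one: "smul V 1 x = x"
    and smul_zero_left: "smul V 0 x = 0"
    and smul_zero_right: "smul V a 0 = 0"
proof -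
  interpret vector_space "smul V"
    using assms by (simp add: is_vspace_def)
  show "smul V a (x + y) = smul V a x + smul V a y" "smul V (a + b) x = smul V a x + smul V b x"
    "smul V a (smul V b x) = smul V (a * b) x" "smul V 1 x = x" "smul V 0 x = 0" "smul V a 0 = 0"
    by (simp_all add: scale_right_distrib scale_left_distrib)
qed

lemma carr_base_field [simp]: "carr base_field = UNIV"
  and smul_base_field [simp]: "smul base_field = (*)"
  by (simp_all add: base_field_def)

lemma smul_tensor_space [simp]: "smul (tensor_space U V) = (\<lambda>a t \<beta>. a * t \<beta>)"
  by (simp add: tensor_space_def)

lemma k_linearI:
  assumes "\<And>x. x \<in> carr V \<Longrightarrow> f x \<in> carr W"
    and "\<And>x y. x \<in> carr V \<Longrightarrow> y \<in> carr V \<Longrightarrow> f (x + y) = f x + f y"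
    and "\<And>a x. x \<in> carr V \<Longrightarrow> f (smul V a x) = smul W a (f x)"
  shows "k_linear V W f"
  using assms by (simp add: k_linear_def)

lemma
  assumes "k_linear V W f"
  shows k_linear_in: "x \<in> carr V \<Longrightarrow> f x \<in> carr W"
    and k_linear_add: "x \<in> carr V \<Longrightarrow> y \<in> carr V \<Longrightarrow> f (x + y) = f x + f y"
    and k_linear_scale: "x \<in> carr V \<Longrightarrow> f (smul V a x) = smul W a (f x)"
  using assms by (simp_all add: k_linear_def)

lemma k_linear_ident: "k_linear V V (\<lambda>x. x)"
  by (simp add: k_linear_def)

lemma k_linear_compose: "k_linear V W f \<Longrightarrow> k_linear W X g \<Longrightarrow> k_linear V X (\<lambda>x. g (f x))"
  by (simp add: k_linear_def)

lemma k_linear_cong: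
  assumes "is_vspace V" and "\<And>x. x \<in> carr V \<Longrightarrow> f x = g x"
  shows "k_linear V W f \<longleftrightarrow> k_linear V W g"
  using assms by (simp add: k_linear_def is_vspace_add is_vspace_scale)

lemma k_linear_plus:
  assumes "is_vspace W" "k_linear V W f" "k_linear V W g"
  shows "k_linear V W (\<lambda>x. f x + g x)"
  using assms by (simp add: k_linear_def is_vspace_add smul_add_right)

lemma k_linear_smul:
  assumes "is_vspace W" "k_linear V W f"
  shows "k_linear V W (\<lambda>x. smul W a (f x))"
  using assms by (simp add: k_linear_def is_vspace_scale smul_add_right smul_smul mult.commute)

lemma k_linear_smul_left:
  assumes "is_vspace W" "k_linear V base_field f" "w \<in> carr W"
  shows "k_linear V W (\<lambda>x. smul W (f x) w)"
  using assms by (simp add: k_linear_def is_vspace_scale smul_add_left smul_smul)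

lemma k_bilinearI:
  assumes "\<And>x. x \<in> carr U \<Longrightarrow> k_linear V W (h x)"
    and "\<And>y. y \<in> carr V \<Longrightarrow> k_linear U W (\<lambda>x. h x y)"
  shows "k_bilinear U V W h"
  using assms by (simp add: k_bilinear_def)

lemma
  assumes "k_bilinear U V W h"
  shows k_bilinear_right: "x \<in> carr U \<Longrightarrow> k_linear V W (h x)"
    and k_bilinear_left: "y \<in> carr V \<Longrightarrow> k_linear U W (\<lambda>x. h x y)"
  using assms by (simp_all add: k_bilinear_def)

lemma k_bilinear_compose:
  assumes "k_bilinear U' V' W h" "k_linear U U' f" "k_linear V V' g"
  shows "k_bilinear U V W (\<lambda>x y. h (f x) (g y))"
proof (rule k_bilinearI)
  show "k_linear V W (\<lambda>y. h (f x) (g y))" if "x \<in> carr U" for x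
    using k_linear_compose[OF assms(3) k_bilinear_right[OF assms(1) k_linear_in[OF assms(2) that]]] .
  show "k_linear U W (\<lambda>x. h (f x) (g y))" if "y \<in> carr V" for y
    using k_linear_compose[OF assms(2) k_bilinear_left[OF assms(1) k_linear_in[OF assms(3) that]]] .
qed

lemma k_linear_bilinear:
  assumes "k_bilinear U V W h" "k_linear W X g"
  shows "k_bilinear U V X (\<lambda>x y. g (h x y))"
  using assms by (simp add: k_bilinear_def k_linear_def)

text \<open>\<open>tens\<close> tests its argument for bilinearity as a HOL function, so values off
  the carriers must not affect the outcome of that test.\<close>

lemma k_bilinear_cong:
  assumes "is_vspace U" "is_vspace V"
    and "\<And>x y. x \<in> carr U \<Longrightarrow> y \<in> carr V \<Longrightarrow> h x y = h' x y"
  shows "k_bilinear U V W h \<longleftrightarrow> k_bilinear U V W h'"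
proof -
  have "k_linear V W (h x) \<longleftrightarrow> k_linear V W (h' x)" if "x \<in> carr U" for x
    using assms that by (intro k_linear_cong) auto
  moreover have "k_linear U W (\<lambda>x. h x y) \<longleftrightarrow> k_linear U W (\<lambda>x. h' x y)" if "y \<in> carr V" for y
    using assms that by (intro k_linear_cong) auto
  ultimately show ?thesis
    by (simp add: k_bilinear_def)
qed

lemma k_bilinear_smul:
  assumes "is_vspace W" "k_linear U base_field f" "k_linear V W g"
  shows "k_bilinear U V W (\<lambda>x y. smul W (f x) (g y))"
proof (rule k_bilinearI)
  show "k_linear V W (\<lambda>y. smul W (f x) (g y))" for x
    using assms(1,3) by (rule k_linear_smul)
  show "k_linear U W (\<lambda>x. smul W (f x) (g y))" if "y \<in> carr V" for y
    using assms(1,2) k_linear_in[OF assms(3) that] by (rule k_linear_smul_left)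
qed

section \<open>Maps out of a tensor product\<close>

lemma tens_in: "x \<in> carr U \<Longrightarrow> y \<in> carr V \<Longrightarrow> tens U V x y \<in> carr (tensor_space U V)"
  using k_bilinear_tens[of U V] by (auto simp: k_bilinear_def k_linear_def)

lemma tens_apply: "k_bilinear U V base_field \<beta> \<Longrightarrow> tens U V x y \<beta> = \<beta> x y"
  by (simp add: tens_def)

text \<open>Uniqueness in the universal property, freed from the normalisation in
  \<open>Vect\<close>: linear maps on a tensor product are compared on pure tensors.\<close>

lemma tensor_linear_eqI:
  assumes W: "is_vspace W" and f: "k_linear (tensor_space U V) W f"
    and g: "k_linear (tensor_space U V) W g"
    and eq: "\<And>x y. x \<in> carr U \<Longrightarrow> y \<in> carr V \<Longrightarrow> f (tens U V x y) = g (tens U V x y)"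
    and t: "t \<in> carr (tensor_space U V)"
  shows "f t = g t"
proof -
  let ?T = "tensor_space U V"
  \<comment> \<open>Truncation to 0 off the carrier puts a linear map into \<open>Vect\<close>,
    where uniqueness is stated.\<close>
  let ?r = "\<lambda>f t. if t \<in> carr ?T then f t else 0"
  have r: "?r f \<in> carr (Vect ?T W)" if "k_linear ?T W f" for f
  proof -
    have "k_linear ?T W (?r f) \<longleftrightarrow> k_linear ?T W f"
      by (rule k_linear_cong) (simp_all add: is_vspace_tensor_space)
    with that show ?thesis
      by (simp add: Vect_def)
  qed
  have "k_bilinear U V W (\<lambda>x y. f (tens U V x y))"
    using k_bilinear_tens f by (rule k_linear_bilinear)
  from tensor_universal_property[OF W this] have "?r f = ?r g"
    by (rule Uniq_D[OF ex1_iff_ex_Uniq[THEN iffD1, THEN conjunct2]]) (use r[OF f] r[OF g] in \<open>simp_all add: tens_in eq\<close>)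
  then show ?thesis
    using t by (auto dest: fun_cong[of _ _ t])
qed

lemma
  assumes "is_vspace W" "k_bilinear U V W h"
  shows k_linear_tensor_lift: "k_linear (tensor_space U V) W (tensor_lift U V W h)"
    and tensor_lift_tens: "x \<in> carr U \<Longrightarrow> y \<in> carr V \<Longrightarrow> tensor_lift U V W h (tens U V x y) = h x y"
  using theI'[OF tensor_universal_property[OF assms]]
  by (simp_all add: tensor_lift_def Vect_def)

lemma tensor_lift_unique:
  assumes "is_vspace W" "k_bilinear U V W h" "k_linear (tensor_space U V) W f"
    and "\<And>x y. x \<in> carr U \<Longrightarrow> y \<in> carr V \<Longrightarrow> f (tens U V x y) = h x y"
    and "t \<in> carr (tensor_space U V)"
  shows "tensor_lift U V W h t = f t"
  by (rule tensor_linear_eqI[OF assms(1) k_linear_tensor_lift[OF assms(1,2)] assms(3) _ assms(5)])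
    (simp add: tensor_lift_tens assms(1,2,4))

lemma tensor_lift_cong:
  assumes "is_vspace U" "is_vspace V"
    and "\<And>x y. x \<in> carr U \<Longrightarrow> y \<in> carr V \<Longrightarrow> h x y = h' x y"
  shows "tensor_lift U V W h = tensor_lift U V W h'"
  using assms by (simp add: tensor_lift_def)

lemma k_linear_tensor_eval: "k_linear (tensor_space U V) base_field (\<lambda>t. t \<beta>)"
  by (simp add: k_linear_def)

text \<open>Evaluation at \<beta> is linear in \<open>t\<close> and has the right values on pure
  tensors, so it is the lift. Scalar Sweedler sums thereby become evaluations.\<close>

lemma tensor_lift_base_field:
  assumes "k_bilinear U V base_field \<beta>" "t \<in> carr (tensor_space U V)"
  shows "tensor_lift U V base_field \<beta> t = t \<beta>"
  by (rule tensor_lift_unique[OF is_vspace_base_field assms(1) k_linear_tensor_eval _ assms(2)])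
    (simp add: tens_apply assms(1))

lemma k_linear_tensor_lift_commute:
  assumes "is_vspace W" "is_vspace X" "k_bilinear U V W h" "k_linear W X g"
    and "t \<in> carr (tensor_space U V)"
  shows "g (tensor_lift U V W h t) = tensor_lift U V X (\<lambda>x y. g (h x y)) t"
  by (rule tensor_lift_unique[OF assms(2) k_linear_bilinear[OF assms(3,4)]
        k_linear_compose[OF k_linear_tensor_lift[OF assms(1,3)] assms(4)] _ assms(5), symmetric])
    (simp add: tensor_lift_tens assms)

lemma k_linear_tensor_lift_eval:
  assumes "is_vspace W" "k_bilinear U V W h" "k_linear W base_field \<phi>"
    and "t \<in> carr (tensor_space U V)"
  shows "\<phi> (tensor_lift U V W h t) = t (\<lambda>x y. \<phi> (h x y))"
  using k_linear_tensor_lift_commute[OF assms(1) is_vspace_base_field assms(2-4)]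
    tensor_lift_base_field[OF k_linear_bilinear[OF assms(2,3)] assms(4)] by simp

text \<open>The two forms may be arbitrary functions: by \<open>k_bilinear_cong\<close> both are
  bilinear or neither is, and at a non-bilinear argument every pure tensor has the default value 0.
  This permits rewriting under an evaluation with arguments taken from the carriers.\<close>

lemma tensor_eval_cong:
  assumes "is_vspace U" "is_vspace V" "t \<in> carr (tensor_space U V)"
    and "\<And>x y. x \<in> carr U \<Longrightarrow> y \<in> carr V \<Longrightarrow> \<beta> x y = \<beta>' x y"
  shows "t \<beta> = t \<beta>'"
  using k_bilinear_cong[OF assms(1,2,4), where W=base_field] assms(4)
  by (intro tensor_linear_eqI[OF is_vspace_base_field k_linear_tensor_eval k_linear_tensor_eval _ assms(3)])
    (simp add: tens_def)

lemma tensor_ext: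
  assumes "t \<in> carr (tensor_space U V)" "t' \<in> carr (tensor_space U V)"
    and "\<And>\<beta>. k_bilinear U V base_field \<beta> \<Longrightarrow> t \<beta> = t' \<beta>"
  shows "t = t'"
proof
  fix \<beta>
  \<comment> \<open>The default 0 in \<open>tens\<close> propagates by linearity from pure tensors
    to all tensors, so only bilinear forms need testing.\<close>
  have "s \<beta> = 0" if "\<not> k_bilinear U V base_field \<beta>" "s \<in> carr (tensor_space U V)" for s
    by (rule tensor_linear_eqI[OF is_vspace_base_field k_linear_tensor_eval _ _ that(2)])
      (simp_all add: tens_def k_linear_def that(1))
  then show "t \<beta> = t' \<beta>"
    using assms by metis
qed

text \<open>The linearity laws in the parameter hold on pure tensors by \<open>lin\<close>, and a
  lift is determined by its values there.\<close>

lemma k_linear_tensor_lift_param: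
  assumes W: "is_vspace W" and X: "is_vspace X"
    and h: "\<And>z. z \<in> carr X \<Longrightarrow> k_bilinear U V W (h z)"
    and lin: "\<And>x y. x \<in> carr U \<Longrightarrow> y \<in> carr V \<Longrightarrow> k_linear X W (\<lambda>z. h z x y)"
    and t: "t \<in> carr (tensor_space U V)"
  shows "k_linear X W (\<lambda>z. tensor_lift U V W (h z) t)"
proof (rule k_linearI)
  fix z assume z: "z \<in> carr X"
  show "tensor_lift U V W (h z) t \<in> carr W"
    using k_linear_in[OF k_linear_tensor_lift[OF W h[OF z]] t] .
  show "tensor_lift U V W (h (smul X a z)) t = smul W a (tensor_lift U V W (h z) t)" for a
    by (rule tensor_lift_unique[OF W h[OF is_vspace_scale[OF X z]]
          k_linear_smul[OF W k_linear_tensor_lift[OF W h[OF z]]] _ t])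
      (simp add: tensor_lift_tens[OF W h] z k_linear_scale[OF lin])
  fix z' assume z': "z' \<in> carr X"
  show "tensor_lift U V W (h (z + z')) t = tensor_lift U V W (h z) t + tensor_lift U V W (h z') t"
    by (rule tensor_lift_unique[OF W h[OF is_vspace_add[OF X z z']]
          k_linear_plus[OF W k_linear_tensor_lift[OF W h[OF z]] k_linear_tensor_lift[OF W h[OF z']]] _ t])
      (simp add: tensor_lift_tens[OF W h] z z' k_linear_add[OF lin])
qed

text \<open>Needed for the associator, whose inner lift depends on the third factor as a
  parameter.\<close>

lemma k_bilinear_tensor_lift_param:
  assumes W: "is_vspace W" and X: "is_vspace X" and F: "k_linear Y (tensor_space U V) F"
    and h: "\<And>z. z \<in> carr X \<Longrightarrow> k_bilinear U V W (h z)"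
    and lin: "\<And>x y. x \<in> carr U \<Longrightarrow> y \<in> carr V \<Longrightarrow> k_linear X W (\<lambda>z. h z x y)"
  shows "k_bilinear Y X W (\<lambda>y z. tensor_lift U V W (h z) (F y))"
proof (rule k_bilinearI)
  show "k_linear X W (\<lambda>z. tensor_lift U V W (h z) (F y))" if "y \<in> carr Y" for y
    using k_linear_tensor_lift_param[OF W X h lin k_linear_in[OF F that]] .
  show "k_linear Y W (\<lambda>y. tensor_lift U V W (h z) (F y))" if "z \<in> carr X" for z
    using k_linear_compose[OF F k_linear_tensor_lift[OF W h[OF that]]] .
qed

text \<open>Evaluation at a non-bilinear argument gives 0, so a form that itself contains an
  evaluation must be shown bilinear before it can be used in the evaluation rules.\<close>

lemma k_bilinear_tensor_eval_param:
  assumes Y: "is_vspace Y" and X: "is_vspace X" and F: "k_linear Y (tensor_space U V) F"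
    and h: "\<And>z. z \<in> carr X \<Longrightarrow> k_bilinear U V base_field (h z)"
    and lin: "\<And>x y. x \<in> carr U \<Longrightarrow> y \<in> carr V \<Longrightarrow> k_linear X base_field (\<lambda>z. h z x y)"
  shows "k_bilinear Y X base_field (\<lambda>y z. F y (h z))"
proof -
  have "k_bilinear Y X base_field (\<lambda>y z. tensor_lift U V base_field (h z) (F y))"
    by (rule k_bilinear_tensor_lift_param[OF is_vspace_base_field X F h lin])
  also have "k_bilinear Y X base_field (\<lambda>y z. tensor_lift U V base_field (h z) (F y)) \<longleftrightarrow> ?thesis"
    by (rule k_bilinear_cong[OF Y X tensor_lift_base_field[OF h k_linear_in[OF F]]])
  finally show ?thesis .
qed

section \<open>Functoriality of the tensor product\<close>

context
  fixes U :: "('k::field, 'u::ab_group_add, 'z) vspace_scheme"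
    and V :: "('k, 'v::ab_group_add, 'y) vspace_scheme"
    and U' :: "('k, 'a::ab_group_add, 'x) vspace_scheme"
    and V' :: "('k, 'b::ab_group_add, 'w) vspace_scheme"
    and f :: "'u \<Rightarrow> 'a" and g :: "'v \<Rightarrow> 'b"
  assumes f: "k_linear U U' f" and g: "k_linear V V' g"
begin

lemma k_bilinear_tensor_map: "k_bilinear U V (tensor_space U' V') (\<lambda>x y. tens U' V' (f x) (g y))"
  using k_bilinear_tens f g by (rule k_bilinear_compose)

lemma k_linear_tensor_map:
  "k_linear (tensor_space U V) (tensor_space U' V') (tensor_map U V U' V' f g)"
  unfolding tensor_map_def
  using is_vspace_tensor_space k_bilinear_tensor_map by (rule k_linear_tensor_lift)

lemma tensor_map_tens:
  "x \<in> carr U \<Longrightarrow> y \<in> carr V \<Longrightarrow> tensor_map U V U' V' f g (tens U V x y) = tens U' V' (f x) (g y)"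
  unfolding tensor_map_def
  using is_vspace_tensor_space k_bilinear_tensor_map by (rule tensor_lift_tens)

lemma tensor_lift_tensor_map:
  assumes "is_vspace W" "k_bilinear U' V' W h" "t \<in> carr (tensor_space U V)"
  shows "tensor_lift U' V' W h (tensor_map U V U' V' f g t) = tensor_lift U V W (\<lambda>x y. h (f x) (g y)) t"
  by (rule tensor_lift_unique[OF assms(1) k_bilinear_compose[OF assms(2) f g]
        k_linear_compose[OF k_linear_tensor_map k_linear_tensor_lift[OF assms(1,2)]] _ assms(3), symmetric])
    (simp add: tensor_map_tens tensor_lift_tens[OF assms(1,2)] k_linear_in[OF f] k_linear_in[OF g])

text \<open>For tensors viewed as functionals, \<open>tensor_map\<close> is pullback of forms; this
  removes it from later computations.\<close>

lemma tensor_map_eval: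
  assumes "k_bilinear U' V' base_field \<beta>" "t \<in> carr (tensor_space U V)"
  shows "tensor_map U V U' V' f g t \<beta> = t (\<lambda>x y. \<beta> (f x) (g y))"
  using tensor_lift_tensor_map[OF is_vspace_base_field assms]
  by (simp add: tensor_lift_base_field assms k_linear_in[OF k_linear_tensor_map] k_bilinear_compose[OF _ f g])

end

section \<open>The associator under evaluation\<close>

lemma k_bilinear_tensor_assoc_inner:
  assumes "k_bilinear U (tensor_space V W) X h" "z \<in> carr W"
  shows "k_bilinear U V X (\<lambda>x y. h x (tens V W y z))"
  by (rule k_bilinear_compose[OF assms(1) k_linear_ident k_bilinear_left[OF k_bilinear_tens assms(2)]])

lemma k_linear_tensor_assoc_inner:
  assumes "k_bilinear U (tensor_space V W) X h" "x \<in> carr U" "y \<in> carr V"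
  shows "k_linear W X (\<lambda>z. h x (tens V W y z))"
  using k_linear_compose[OF k_bilinear_right[OF k_bilinear_tens] k_bilinear_right[OF assms(1)]] assms
  by blast

context
  fixes U :: "('k::field, 'u::ab_group_add, 'z) vspace_scheme"
    and V :: "('k, 'v::ab_group_add, 'y) vspace_scheme"
    and W :: "('k, 'w::ab_group_add, 'x) vspace_scheme"
  assumes vs: "is_vspace U" "is_vspace V" "is_vspace W"
begin

lemma k_bilinear_tensor_assoc:
  "k_bilinear (tensor_space U V) W (tensor_space U (tensor_space V W))
    (\<lambda>t z. tensor_lift U V (tensor_space U (tensor_space V W))
      (\<lambda>x y. tens U (tensor_space V W) x (tens V W y z)) t)"
  by (rule k_bilinear_tensor_lift_param[OF is_vspace_tensor_space vs(3) k_linear_ident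
        k_bilinear_tensor_assoc_inner[OF k_bilinear_tens] k_linear_tensor_assoc_inner[OF k_bilinear_tens]])

lemma k_linear_tensor_assoc:
  "k_linear (tensor_space (tensor_space U V) W) (tensor_space U (tensor_space V W))
    (tensor_assoc U V W)"
  unfolding tensor_assoc_def
  using is_vspace_tensor_space k_bilinear_tensor_assoc by (rule k_linear_tensor_lift)

text \<open>Evaluation at \<beta> commutes with both lifts in \<open>tensor_assoc\<close>, first the
  outer and then the inner one, and the associator disappears.\<close>

lemma tensor_assoc_eval:
  assumes "k_bilinear U (tensor_space V W) base_field \<beta>"
    and "t \<in> carr (tensor_space (tensor_space U V) W)"
  shows "tensor_assoc U V W t \<beta> = t (\<lambda>s z. s (\<lambda>x y. \<beta> x (tens V W y z)))"
proof -
  let ?T = "tensor_space U (tensor_space V W)"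
  have "tensor_assoc U V W t \<beta> =
    t (\<lambda>s z. tensor_lift U V ?T (\<lambda>x y. tens U (tensor_space V W) x (tens V W y z)) s \<beta>)"
    unfolding tensor_assoc_def
    by (rule k_linear_tensor_lift_eval[OF is_vspace_tensor_space k_bilinear_tensor_assoc
          k_linear_tensor_eval assms(2)])
  also have "\<dots> = t (\<lambda>s z. s (\<lambda>x y. \<beta> x (tens V W y z)))"
  proof (rule tensor_eval_cong[OF is_vspace_tensor_space vs(3) assms(2)])
    fix s z assume s: "s \<in> carr (tensor_space U V)" and z: "z \<in> carr W"
    have "tensor_lift U V ?T (\<lambda>x y. tens U (tensor_space V W) x (tens V W y z)) s \<beta> =
        s (\<lambda>x y. tens U (tensor_space V W) x (tens V W y z) \<beta>)"
      by (rule k_linear_tensor_lift_eval[OF is_vspace_tensor_space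
            k_bilinear_tensor_assoc_inner[OF k_bilinear_tens z] k_linear_tensor_eval s])
    then show "tensor_lift U V ?T (\<lambda>x y. tens U (tensor_space V W) x (tens V W y z)) s \<beta> =
        s (\<lambda>x y. \<beta> x (tens V W y z))"
      by (simp add: tens_apply[OF assms(1)])
  qed
  finally show ?thesis .
qed

end

section \<open>Coassociativity\<close>

text \<open>In Sweedler notation, \<open>\<beta>(c\<^sub>1, c\<^sub>2 \<otimes> d) = \<beta>(c, \<delta> d)\<close> for \<open>\<delta> y = c \<otimes> d\<close>.\<close>

definition coassoc_at ::
  "('k::field, 'c::ab_group_add, 'z) coalgebra_scheme
    \<Rightarrow> ('k, 'd::ab_group_add, 'y) vspace_scheme \<Rightarrow> ('d \<Rightarrow> ('k, 'c, 'd) tensor) \<Rightarrow> 'd \<Rightarrow> bool" where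
  "coassoc_at C D \<delta> y \<longleftrightarrow> (\<forall>\<beta>. k_bilinear C (tensor_space C D) base_field \<beta> \<longrightarrow>
    \<delta> y (\<lambda>c d. comult C c (\<lambda>a b. \<beta> a (tens C D b d))) = \<delta> y (\<lambda>a d. \<beta> a (\<delta> d)))"

context
  fixes C :: "('k::field, 'c::ab_group_add, 'z) coalgebra_scheme"
    and V :: "('k, 'v::ab_group_add, 'y) vspace_scheme"
  assumes C: "is_vspace C" and \<Delta>: "k_linear C (tensor_space C C) (comult C)" and V: "is_vspace V"
begin

lemma k_bilinear_comult_eval:
  assumes "k_bilinear C (tensor_space C V) base_field \<beta>"
  shows "k_bilinear C V base_field (\<lambda>c d. comult C c (\<lambda>a b. \<beta> a (tens C V b d)))"
  by (rule k_bilinear_tensor_eval_param[OF C V \<Delta>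
        k_bilinear_tensor_assoc_inner[OF assms]
        k_linear_tensor_assoc_inner[OF assms]])

lemma k_linear_assoc_comult:
  "k_linear (tensor_space C V) (tensor_space C (tensor_space C V))
    (\<lambda>t. tensor_assoc C C V (tensor_map C V (tensor_space C C) V (comult C) (\<lambda>z. z) t))"
  by (rule k_linear_compose[OF k_linear_tensor_map[OF \<Delta> k_linear_ident] k_linear_tensor_assoc[OF C C V]])

lemma assoc_comult_eval:
  assumes \<beta>: "k_bilinear C (tensor_space C V) base_field \<beta>" and t: "t \<in> carr (tensor_space C V)"
  shows "tensor_assoc C C V (tensor_map C V (tensor_space C C) V (comult C) (\<lambda>z. z) t) \<beta> =
    t (\<lambda>c v. comult C c (\<lambda>a b. \<beta> a (tens C V b v)))"
proof -
  have "k_bilinear (tensor_space C C) V base_field (\<lambda>s z. s (\<lambda>x y. \<beta> x (tens C V y z)))"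
    by (rule k_bilinear_tensor_eval_param[OF is_vspace_tensor_space V k_linear_ident
          k_bilinear_tensor_assoc_inner[OF \<beta>]
          k_linear_tensor_assoc_inner[OF \<beta>]])
  then show ?thesis
    by (simp add: tensor_assoc_eval[OF C C V \<beta> k_linear_in[OF k_linear_tensor_map[OF \<Delta> k_linear_ident] t]]
      tensor_map_eval[OF \<Delta> k_linear_ident _ t])
qed

text \<open>By \<open>tensor_ext\<close> the usual law in C \<otimes> (C \<otimes> V) can be tested
  on bilinear forms, and evaluating its two sides gives the two sides of
  \<open>coassoc_at\<close>.\<close>

lemma coassoc_at_iff:
  assumes \<delta>: "k_linear V (tensor_space C V) \<delta>" and y: "y \<in> carr V"
  shows "coassoc_at C V \<delta> y \<longleftrightarrow>
    tensor_assoc C C V (tensor_map C V (tensor_space C C) V (comult C) (\<lambda>z. z) (\<delta> y)) =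
    tensor_map C V C (tensor_space C V) (\<lambda>z. z) \<delta> (\<delta> y)" (is "_ \<longleftrightarrow> ?l = ?r")
proof -
  note in\<delta> = k_linear_in[OF \<delta> y]
  have "?l = ?r \<longleftrightarrow> (\<forall>\<beta>. k_bilinear C (tensor_space C V) base_field \<beta> \<longrightarrow> ?l \<beta> = ?r \<beta>)"
    using tensor_ext[OF k_linear_in[OF k_linear_assoc_comult in\<delta>]
        k_linear_in[OF k_linear_tensor_map[OF k_linear_ident \<delta>] in\<delta>]] by auto
  then show ?thesis
    by (auto simp: coassoc_at_def assoc_comult_eval in\<delta> tensor_map_eval[OF k_linear_ident \<delta>])
qed

end

section \<open>Dependence of the constructions on carrier and scalars only\<close>

context
  fixes V :: "('k::field, 'v::ab_group_add, 'z) vspace_scheme"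
    and V' :: "('k, 'v, 'y) vspace_scheme"
  assumes eq: "carr V = carr V'" "smul V = smul V'"
begin

text \<open>A comodule and its underlying space are distinct records, for instance
  \<open>cofree_comodule C V\<close> and \<open>tensor_space C V\<close>. The congruences in this
  block identify the constructions on the two.\<close>

lemma is_vspace_carr_smul_cong: "is_vspace V \<longleftrightarrow> is_vspace V'"
  using eq by (simp add: is_vspace_def)

lemma k_linear_carr_smul_cong: "k_linear V = k_linear V'" "k_linear U V = k_linear U V'"
  using eq by (auto simp: k_linear_def fun_eq_iff)

lemma k_bilinear_carr_smul_cong: "k_bilinear U V W h \<longleftrightarrow> k_bilinear U V' W h"
  by (simp add: k_bilinear_def k_linear_carr_smul_cong eq(1))

lemma tens_carr_smul_cong: "tens U V = tens U V'"
  by (simp add: tens_def k_bilinear_carr_smul_cong fun_eq_iff)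

lemma tensor_space_carr_smul_cong: "tensor_space U V = tensor_space U V'"
  by (simp add: tensor_space_def tens_carr_smul_cong eq(1))

lemma tensor_lift_carr_smul_cong: "tensor_lift U V = tensor_lift U V'"
    "tensor_lift X Y V = tensor_lift X Y V'"
  by (simp_all add: tensor_lift_def tens_carr_smul_cong tensor_space_carr_smul_cong eq(1) Vect_def
      k_linear_carr_smul_cong fun_eq_iff)

lemma tensor_map_carr_smul_cong: "tensor_map U V = tensor_map U V'"
    "tensor_map X Y U V f g t = tensor_map X Y U V' f g t"
  by (simp_all add: tensor_map_def tensor_lift_carr_smul_cong tensor_space_carr_smul_cong
      tens_carr_smul_cong fun_eq_iff)

end

section \<open>Composition of tensor maps, linear retractions and spans\<close>

lemma tensor_map_compose:
  assumes f: "k_linear U U' f" and g: "k_linear V V' g"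
    and f': "k_linear U' U'' f'" and g': "k_linear V' V'' g'"
    and t: "t \<in> carr (tensor_space U V)"
  shows "tensor_map U' V' U'' V'' f' g' (tensor_map U V U' V' f g t) =
    tensor_map U V U'' V'' (\<lambda>x. f' (f x)) (\<lambda>y. g' (g y)) t"
proof -
  note gg = k_linear_compose[OF g g'] and ff = k_linear_compose[OF f f']
  show ?thesis
    by (rule tensor_linear_eqI[OF is_vspace_tensor_space
          k_linear_compose[OF k_linear_tensor_map[OF f g] k_linear_tensor_map[OF f' g']]
          k_linear_tensor_map[OF ff gg] _ t])
      (simp add: tensor_map_tens[OF f g] tensor_map_tens[OF f' g'] tensor_map_tens[OF ff gg]
        k_linear_in[OF f] k_linear_in[OF g])
qed

lemma tensor_map_ident:
  assumes t: "t \<in> carr (tensor_space U V)"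
    and g: "k_linear V V g" "\<And>y. y \<in> carr V \<Longrightarrow> g y = y"
  shows "tensor_map U V U V (\<lambda>x. x) g t = t"
  by (rule tensor_linear_eqI[OF is_vspace_tensor_space k_linear_tensor_map[OF k_linear_ident g(1)]
        k_linear_ident _ t])
    (simp add: tensor_map_tens[OF k_linear_ident g(1)] g(2))

text \<open>The identity is injective on the subspace \<open>carr V\<close>, and over a field its
  restriction there has a linear left inverse defined on the whole ambient space with values in
  \<open>carr V\<close>.\<close>

lemma ex_linear_retraction:
  fixes V :: "('k::field, 'v::ab_group_add, 'z) vspace_scheme"
    and W :: "('k, 'v, 'y) vspace_scheme"
  assumes V: "is_vspace V" and W: "is_vspace W"
    and sub: "carr V \<subseteq> carr W" "smul V = smul W"
  obtains \<pi> where "k_linear W V \<pi>" "\<And>x. x \<in> carr V \<Longrightarrow> \<pi> x = x"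
proof -
  interpret vector_space "smul W"
    using W by (simp add: is_vspace_def)
  interpret vector_space_pair "smul W" "smul W" ..
  have "subspace (carr V)"
    using V sub by (simp add: is_vspace_def)
  from linear_exists_left_inverse_on[OF linear_id this] obtain \<pi>
    where \<pi>: "\<pi> ` UNIV \<subseteq> carr V" "Vector_Spaces.linear (smul W) (smul W) \<pi>"
      "\<forall>x\<in>carr V. \<pi> (id x) = x"
    by (auto simp: id_def inj_on_def)
  show ?thesis
  proof (rule that)
    show "k_linear W V \<pi>"
      using \<pi> by (intro k_linearI) (auto simp: linear_add linear_scale sub)
  qed (use \<pi> in auto)
qed

lemma k_linear_inclusion:
  "carr V \<subseteq> carr W \<Longrightarrow> smul V = smul W \<Longrightarrow> k_linear V W (\<lambda>x. x)"
  by (auto simp: k_linear_def)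

lemma k_linear_eq_on_span:
  assumes V: "is_vspace V" and W: "is_vspace W" and f: "k_linear V W f" and g: "k_linear V W g"
    and S: "S \<subseteq> carr V" "\<And>x. x \<in> S \<Longrightarrow> f x = g x" and x: "x \<in> module.span (smul V) S"
  shows "f x = g x"
proof -
  interpret vector_space "smul V"
    using V by (simp add: is_vspace_def)
  have zero: "h 0 = 0" if "k_linear V W h" for h
    using k_linear_scale[OF that is_vspace_zero[OF V], of 0]
    by (simp add: smul_zero_left[OF V] smul_zero_left[OF W])
  \<comment> \<open>Membership is carried through the induction because \<open>f\<close> and
    \<open>g\<close> are linear on the carrier only.\<close>
  have "x \<in> carr V \<and> f x = g x"
    using x
  proof (induction rule: span_induct_alt)
    case base
    show ?case
      using zero[OF f] zero[OF g] by (simp add: is_vspace_zero[OF V])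
  next
    case (step c x y)
    then have "x \<in> carr V"
      using S by blast
    with step show ?case
      using S by (simp add: is_vspace_add[OF V] is_vspace_scale[OF V]
          k_linear_add[OF f] k_linear_add[OF g] k_linear_scale[OF f] k_linear_scale[OF g])
  qed
  then show ?thesis ..
qed

section \<open>Consequences of the coalgebra and comodule axioms\<close>

lemma
  assumes "is_coalgebra C"
  shows is_vspace_coalgebra: "is_vspace C"
    and k_linear_comult: "k_linear C (tensor_space C C) (comult C)"
    and k_linear_counit: "k_linear C base_field (counit C)"
    and comult_counit: "c \<in> carr C \<Longrightarrow> tensor_lift C C C (\<lambda>a b. smul C (counit C a) b) (comult C c) = c"
  using assms by (simp_all add: is_coalgebra_def)

lemma coalgebra_coassoc_at:
  assumes "is_coalgebra C" "c \<in> carr C"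
  shows "coassoc_at C C (comult C) c"
  using assms coassoc_at_iff[of C C "comult C" c] by (simp add: is_coalgebra_def)

lemma is_comodule_iff:
  assumes "is_coalgebra C"
  shows "is_comodule C D \<longleftrightarrow> is_vspace D \<and> k_linear D (tensor_space C D) (coact D) \<and>
    (\<forall>y\<in>carr D. coassoc_at C D (coact D) y) \<and>
    (\<forall>y\<in>carr D. tensor_lift C D D (\<lambda>a z. smul D (counit C a) z) (coact D y) = y)"
  using coassoc_at_iff[OF is_vspace_coalgebra[OF assms] k_linear_comult[OF assms], of D "coact D"]
  by (auto simp: is_comodule_def)

lemma coassoc_atD:
  "coassoc_at C D \<delta> y \<Longrightarrow> k_bilinear C (tensor_space C D) base_field \<beta> \<Longrightarrow>
    \<delta> y (\<lambda>c d. comult C c (\<lambda>a b. \<beta> a (tens C D b d))) = \<delta> y (\<lambda>a d. \<beta> a (\<delta> d))"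
  by (simp add: coassoc_at_def)

lemma is_vspace_comodule: "is_comodule C D \<Longrightarrow> is_vspace D"
  and k_linear_coact: "is_comodule C D \<Longrightarrow> k_linear D (tensor_space C D) (coact D)"
  and coact_counit: "is_comodule C D \<Longrightarrow> y \<in> carr D \<Longrightarrow>
    tensor_lift C D D (\<lambda>a z. smul D (counit C a) z) (coact D y) = y"
  by (simp_all add: is_comodule_def)

section \<open>The cofree comodule\<close>

lemma carr_cofree [simp]: "carr (cofree_comodule C V) = carr (tensor_space C V)"
  and smul_cofree [simp]: "smul (cofree_comodule C V) = smul (tensor_space C V)"
  by (simp_all add: cofree_comodule_def)

context
  fixes C :: "('k::field, 'c::ab_group_add) coalgebra"
    and V :: "('k, 'v::ab_group_add) vspace"
  assumes C: "is_coalgebra C" and V: "is_vspace V"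
begin

lemma k_linear_coact_cofree:
  "k_linear (tensor_space C V) (tensor_space C (tensor_space C V)) (coact (cofree_comodule C V))"
  using k_linear_assoc_comult[OF is_vspace_coalgebra[OF C] k_linear_comult[OF C] V] by (simp add: cofree_comodule_def)

text \<open>In Sweedler notation the coaction is \<open>c \<otimes> v \<mapsto> c\<^sub>1 \<otimes>
  (c\<^sub>2 \<otimes> v)\<close>.\<close>

lemma coact_cofree_eval:
  assumes "k_bilinear C (tensor_space C V) base_field \<beta>" "t \<in> carr (tensor_space C V)"
  shows "coact (cofree_comodule C V) t \<beta> = t (\<lambda>c v. comult C c (\<lambda>a b. \<beta> a (tens C V b v)))"
  using assoc_comult_eval[OF is_vspace_coalgebra[OF C] k_linear_comult[OF C] V assms] by (simp add: cofree_comodule_def)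

text \<open>Both sides are \<open>t\<close> evaluated at a form in c and v; for fixed v the two
  forms agree by coassociativity of \<open>C\<close> at c.\<close>

lemma coassoc_at_cofree:
  assumes t: "t \<in> carr (tensor_space C V)"
  shows "coassoc_at C (tensor_space C V) (coact (cofree_comodule C V)) t"
  unfolding coassoc_at_def
proof (intro allI impI)
  let ?T = "tensor_space C V" and ?\<delta> = "coact (cofree_comodule C V)"
  fix \<beta> assume \<beta>: "k_bilinear C (tensor_space C ?T) base_field \<beta>"
  note bT = is_vspace_tensor_space
  have \<gamma>1: "k_bilinear C ?T base_field (\<lambda>c s. comult C c (\<lambda>a b. \<beta> a (tens C ?T b s)))"
    by (rule k_bilinear_comult_eval[OF is_vspace_coalgebra[OF C] k_linear_comult[OF C] bT \<beta>])
  have \<gamma>2: "k_bilinear C ?T base_field (\<lambda>a s. \<beta> a (?\<delta> s))"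
    by (rule k_bilinear_compose[OF \<beta> k_linear_ident k_linear_coact_cofree])
  have "?\<delta> t (\<lambda>c s. comult C c (\<lambda>a b. \<beta> a (tens C ?T b s))) =
      t (\<lambda>c v. comult C c (\<lambda>p q. comult C p (\<lambda>a b. \<beta> a (tens C ?T b (tens C V q v)))))"
    by (rule coact_cofree_eval[OF \<gamma>1 t])
  also have "\<dots> = t (\<lambda>c v. comult C c (\<lambda>a q. \<beta> a (?\<delta> (tens C V q v))))"
  proof (rule tensor_eval_cong[OF is_vspace_coalgebra[OF C] V t])
    fix c v assume c: "c \<in> carr C" and v: "v \<in> carr V"
    \<comment> \<open>With v fixed, the lift of \<open>f\<close> is the map b \<otimes> q \<mapsto>
      b \<otimes> (q \<otimes> v). Composing \<beta> with it yields a form \<gamma> to which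
      coassociativity of \<open>C\<close> applies.\<close>
    define f where "f = (\<lambda>b q. tens C ?T b (tens C V q v))"
    have f: "k_bilinear C C (tensor_space C ?T) f"
      unfolding f_def
      by (rule k_bilinear_compose[OF k_bilinear_tens k_linear_ident k_bilinear_left[OF k_bilinear_tens v]])
    note linf = k_linear_tensor_lift[OF bT f]
    have \<gamma>: "k_bilinear C (tensor_space C C) base_field (\<lambda>a s. \<beta> a (tensor_lift C C (tensor_space C ?T) f s))"
      by (rule k_bilinear_compose[OF \<beta> k_linear_ident linf])
    \<comment> \<open>The lift of \<open>f\<close> sends the comultiplication of q to the coaction
      of q \<otimes> v, so the form \<gamma> produces the inner coaction.\<close>
    have \<delta>: "tensor_lift C C (tensor_space C ?T) f (comult C q) = ?\<delta> (tens C V q v)" if q: "q \<in> carr C" for q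
    proof (rule tensor_ext)
      note \<Delta>q = k_linear_in[OF k_linear_comult[OF C] q]
      show "tensor_lift C C (tensor_space C ?T) f (comult C q) \<in> carr (tensor_space C ?T)"
        by (rule k_linear_in[OF linf \<Delta>q])
      show "?\<delta> (tens C V q v) \<in> carr (tensor_space C ?T)"
        by (rule k_linear_in[OF k_linear_coact_cofree tens_in[OF q v]])
      fix \<beta>' assume \<beta>': "k_bilinear C ?T base_field \<beta>'"
      have "tensor_lift C C (tensor_space C ?T) f (comult C q) \<beta>' = comult C q (\<lambda>x y. f x y \<beta>')"
        by (rule k_linear_tensor_lift_eval[OF bT f k_linear_tensor_eval \<Delta>q])
      also have "\<dots> = ?\<delta> (tens C V q v) \<beta>'"
        by (simp add: coact_cofree_eval[OF \<beta>' tens_in[OF q v]] f_def tens_apply \<beta>'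
            k_bilinear_comult_eval[OF is_vspace_coalgebra[OF C] k_linear_comult[OF C] V])
      finally show "tensor_lift C C (tensor_space C ?T) f (comult C q) \<beta>' = ?\<delta> (tens C V q v) \<beta>'" .
    qed
    have "comult C c (\<lambda>p q. comult C p (\<lambda>a b. \<beta> a (f b q))) =
        comult C c (\<lambda>p q. comult C p (\<lambda>a b. \<beta> a (tensor_lift C C (tensor_space C ?T) f (tens C C b q))))"
      by (intro tensor_eval_cong[OF is_vspace_coalgebra[OF C] is_vspace_coalgebra[OF C] k_linear_in[OF k_linear_comult[OF C]]] c)
        (simp_all add: tensor_lift_tens[OF bT f])
    also have "\<dots> = comult C c (\<lambda>a q. \<beta> a (tensor_lift C C (tensor_space C ?T) f (comult C q)))"
      by (rule coassoc_atD[OF coalgebra_coassoc_at[OF C c] \<gamma>])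
    also have "\<dots> = comult C c (\<lambda>a q. \<beta> a (?\<delta> (tens C V q v)))"
      by (intro tensor_eval_cong[OF is_vspace_coalgebra[OF C] is_vspace_coalgebra[OF C] k_linear_in[OF k_linear_comult[OF C]]] c) (simp add: \<delta>)
    finally show "comult C c (\<lambda>p q. comult C p (\<lambda>a b. \<beta> a (tens C ?T b (tens C V q v)))) =
        comult C c (\<lambda>a q. \<beta> a (?\<delta> (tens C V q v)))"
      by (simp add: f_def)
  qed
  also have "\<dots> = ?\<delta> t (\<lambda>a s. \<beta> a (?\<delta> s))"
    by (rule coact_cofree_eval[OF \<gamma>2 t, symmetric])
  finally show "?\<delta> t (\<lambda>c s. comult C c (\<lambda>a b. \<beta> a (tens C ?T b s))) = ?\<delta> t (\<lambda>a s. \<beta> a (?\<delta> s))" .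
qed

text \<open>For fixed v this is the left counit law of \<open>C\<close>, since the coaction only
  splits the first tensor factor.\<close>

lemma cofree_counit:
  assumes t: "t \<in> carr (tensor_space C V)"
  shows "tensor_lift C (tensor_space C V) (tensor_space C V)
    (\<lambda>a s. smul (tensor_space C V) (counit C a) s) (coact (cofree_comodule C V) t) = t"
    (is "tensor_lift C ?T ?T ?h (?\<delta> t) = t")
proof (rule tensor_ext)
  note bT = is_vspace_tensor_space[of C V]
  have h: "k_bilinear C ?T ?T ?h"
    by (rule k_bilinear_smul[OF bT k_linear_counit[OF C] k_linear_ident])
  note \<delta>t = k_linear_in[OF k_linear_coact_cofree t]
  show "tensor_lift C ?T ?T ?h (?\<delta> t) \<in> carr ?T"
    by (rule k_linear_in[OF k_linear_tensor_lift[OF bT h] \<delta>t])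
  show "t \<in> carr ?T" by (rule t)
  fix \<beta> assume \<beta>: "k_bilinear C V base_field \<beta>"
  have "tensor_lift C ?T ?T ?h (?\<delta> t) \<beta> = ?\<delta> t (\<lambda>a s. ?h a s \<beta>)"
    by (rule k_linear_tensor_lift_eval[OF bT h k_linear_tensor_eval \<delta>t])
  also have "\<dots> = t (\<lambda>c v. comult C c (\<lambda>a b. ?h a (tens C V b v) \<beta>))"
    by (rule coact_cofree_eval[OF k_linear_bilinear[OF h k_linear_tensor_eval] t])
  also have "\<dots> = t \<beta>"
  proof (rule tensor_eval_cong[OF is_vspace_coalgebra[OF C] V t])
    fix c v assume c: "c \<in> carr C" and v: "v \<in> carr V"
    \<comment> \<open>Moving the scalar into the first argument of \<beta> exposes the sum that the
      counit law of \<open>C\<close> collapses to c.\<close>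
    have "comult C c (\<lambda>a b. ?h a (tens C V b v) \<beta>) = comult C c (\<lambda>a b. \<beta> (smul C (counit C a) b) v)"
      by (rule tensor_eval_cong[OF is_vspace_coalgebra[OF C] is_vspace_coalgebra[OF C] k_linear_in[OF k_linear_comult[OF C] c]])
        (simp add: tens_apply[OF \<beta>] k_linear_scale[OF k_bilinear_left[OF \<beta> v]])
    also have "\<dots> = \<beta> (tensor_lift C C C (\<lambda>a b. smul C (counit C a) b) (comult C c)) v"
      by (rule k_linear_tensor_lift_eval[OF is_vspace_coalgebra[OF C] k_bilinear_smul[OF is_vspace_coalgebra[OF C] k_linear_counit[OF C] k_linear_ident]
            k_bilinear_left[OF \<beta> v] k_linear_in[OF k_linear_comult[OF C] c], symmetric])
    finally show "comult C c (\<lambda>a b. ?h a (tens C V b v) \<beta>) = \<beta> c v"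
      by (simp add: comult_counit[OF C c])
  qed
  finally show "tensor_lift C ?T ?T ?h (?\<delta> t) \<beta> = t \<beta>" .
qed

lemma is_comodule_cofree: "is_comodule C (cofree_comodule C V)"
proof -
  let ?F = "cofree_comodule C V" and ?T = "tensor_space C V"
  note cong = carr_cofree smul_cofree
  have "coassoc_at C ?F (coact ?F) t \<longleftrightarrow> coassoc_at C ?T (coact ?F) t" for t
    unfolding coassoc_at_def tensor_space_carr_smul_cong[OF cong] tens_carr_smul_cong[OF cong] ..
  then show ?thesis
    unfolding is_comodule_iff[OF C] tensor_space_carr_smul_cong[OF cong] k_linear_carr_smul_cong[OF cong]
      tensor_lift_carr_smul_cong[OF cong] is_vspace_carr_smul_cong[OF cong] carr_cofree
      smul_cofree \<open>\<And>t. coassoc_at C ?F (coact ?F) t \<longleftrightarrow> coassoc_at C ?T (coact ?F) t\<close>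
    using is_vspace_tensor_space k_linear_coact_cofree coassoc_at_cofree cofree_counit
    by blast
qed

end

lemma
  assumes "comodule_morphism C D E \<chi>"
  shows k_linear_comodule_morphism: "k_linear D E \<chi>"
    and comodule_morphism_coact: "y \<in> carr D \<Longrightarrow> coact E (\<chi> y) = tensor_map C D C E (\<lambda>a. a) \<chi> (coact D y)"
  using assms by (simp_all add: comodule_morphism_def)

section \<open>The morphism into a cofree comodule induced by a linear map\<close>

context
  fixes C :: "('k::field, 'c::ab_group_add) coalgebra"
    and V :: "('k, 'v::ab_group_add) vspace"
    and D :: "('k, 'c, 'd::ab_group_add) comodule"
    and f :: "'d \<Rightarrow> 'v"
  assumes C: "is_coalgebra C" and V: "is_vspace V" and D: "is_comodule C D" and f: "k_linear D V f"
begin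

private abbreviation (input) "cofree_map \<equiv> \<lambda>y. tensor_map C D C V (\<lambda>a. a) f (coact D y)"

lemma k_linear_cofree_map: "k_linear D (tensor_space C V) cofree_map"
  by (rule k_linear_compose[OF k_linear_coact[OF D] k_linear_tensor_map[OF k_linear_ident f]])

text \<open>This is coassociativity of \<open>D\<close> with \<open>f\<close> applied to the last
  tensor factor.\<close>

lemma comodule_morphism_cofree_map: "comodule_morphism C D (cofree_comodule C V) cofree_map"
  unfolding comodule_morphism_def
proof (intro conjI ballI)
  let ?F = "cofree_comodule C V" and ?T = "tensor_space C V" and ?\<chi> = "cofree_map"
  note cong = carr_cofree[of C V] smul_cofree[of C V]
  show "k_linear D ?F ?\<chi>"
    using k_linear_cofree_map by (simp add: k_linear_carr_smul_cong[OF cong])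
  fix y assume y: "y \<in> carr D"
  note vD = is_vspace_comodule[OF D] and vC = is_vspace_coalgebra[OF C]
  note coy = k_linear_in[OF k_linear_coact[OF D] y]
  note fm = tensor_map_tens[OF k_linear_ident f]
  have "coact ?F (?\<chi> y) = tensor_map C D C ?T (\<lambda>a. a) ?\<chi> (coact D y)"
  proof (rule tensor_ext)
    show "coact ?F (?\<chi> y) \<in> carr (tensor_space C ?T)"
      by (rule k_linear_in[OF k_linear_coact_cofree[OF C V] k_linear_in[OF k_linear_cofree_map y]])
    show "tensor_map C D C ?T (\<lambda>a. a) ?\<chi> (coact D y) \<in> carr (tensor_space C ?T)"
      by (rule k_linear_in[OF k_linear_tensor_map[OF k_linear_ident k_linear_cofree_map] coy])
    fix \<beta> assume \<beta>: "k_bilinear C ?T base_field \<beta>"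
    let ?r = "tensor_map C D C V (\<lambda>a. a) f"
    \<comment> \<open>Pulling \<beta> back along id \<otimes> f gives a form over \<open>D\<close>,
      the one at which coassociativity of \<open>D\<close> is used.\<close>
    have \<gamma>: "k_bilinear C (tensor_space C D) base_field (\<lambda>a s. \<beta> a (?r s))"
      by (rule k_bilinear_compose[OF \<beta> k_linear_ident k_linear_tensor_map[OF k_linear_ident f]])
    have "coact ?F (?\<chi> y) \<beta> = ?\<chi> y (\<lambda>c v. comult C c (\<lambda>a b. \<beta> a (tens C V b v)))"
      by (rule coact_cofree_eval[OF C V \<beta> k_linear_in[OF k_linear_cofree_map y]])
    also have "\<dots> = coact D y (\<lambda>c d. comult C c (\<lambda>a b. \<beta> a (tens C V b (f d))))"
      by (rule tensor_map_eval[OF k_linear_ident f k_bilinear_comult_eval[OF vC k_linear_comult[OF C] V \<beta>] coy])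
    also have "\<dots> = coact D y (\<lambda>c d. comult C c (\<lambda>a b. \<beta> a (?r (tens C D b d))))"
      by (intro tensor_eval_cong[OF vC vD coy] tensor_eval_cong[OF vC vC k_linear_in[OF k_linear_comult[OF C]]])
        (simp_all add: fm)
    also have "\<dots> = coact D y (\<lambda>a d. \<beta> a (?\<chi> d))"
      using D y by (intro coassoc_atD[OF _ \<gamma>]) (simp add: is_comodule_iff[OF C])
    also have "\<dots> = tensor_map C D C ?T (\<lambda>a. a) ?\<chi> (coact D y) \<beta>"
      by (rule tensor_map_eval[OF k_linear_ident k_linear_cofree_map \<beta> coy, symmetric])
    finally show "coact ?F (?\<chi> y) \<beta> = tensor_map C D C ?T (\<lambda>a. a) ?\<chi> (coact D y) \<beta>" .
  qed
  then show "coact ?F (?\<chi> y) = tensor_map C D C ?F (\<lambda>a. a) ?\<chi> (coact D y)"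
    by (simp add: tensor_map_carr_smul_cong[OF cong])
qed

text \<open>Linearity moves the counit inside \<open>f\<close>, where the counit law of
  \<open>D\<close> recovers \<open>y\<close>.\<close>

lemma cofree_proj_cofree_map:
  assumes y: "y \<in> carr D"
  shows "cofree_proj C V (cofree_map y) = f y"
proof -
  note vD = is_vspace_comodule[OF D] and vC = is_vspace_coalgebra[OF C]
  note coy = k_linear_in[OF k_linear_coact[OF D] y]
  have "cofree_proj C V (cofree_map y) = tensor_lift C D V (\<lambda>a z. smul V (counit C a) (f z)) (coact D y)"
    unfolding cofree_proj_def
    by (rule tensor_lift_tensor_map[OF k_linear_ident f V
          k_bilinear_smul[OF V k_linear_counit[OF C] k_linear_ident] coy])
  also have "\<dots> = tensor_lift C D V (\<lambda>a z. f (smul D (counit C a) z)) (coact D y)"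
    by (rule fun_cong[OF tensor_lift_cong[OF vC vD]]) (simp add: k_linear_scale[OF f])
  also have "\<dots> = f (tensor_lift C D D (\<lambda>a z. smul D (counit C a) z) (coact D y))"
    by (rule k_linear_tensor_lift_commute[OF vD V
          k_bilinear_smul[OF vD k_linear_counit[OF C] k_linear_ident] f coy, symmetric])
  finally show ?thesis
    by (simp add: coact_counit[OF D y])
qed

end

lemma k_linear_cofree_proj:
  assumes "is_coalgebra C" "is_vspace V"
  shows "k_linear (cofree_comodule C V) V (cofree_proj C V)"
  unfolding cofree_proj_def k_linear_carr_smul_cong[OF carr_cofree[of C V] smul_cofree[of C V]]
  by (rule k_linear_tensor_lift[OF assms(2) k_bilinear_smul[OF assms(2) k_linear_counit[OF assms(1)] k_linear_ident]])

section \<open>Subcomodules\<close>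

text \<open>The coaction is the preimage of that of \<open>F\<close> in C \<otimes> V, unique for a
  subspace by \<open>inj_on_tensor_map_inclusion\<close>. The description matches
  \<open>univ_comodule\<close>, so that one criterion serves both images and sums.\<close>

definition subcomod ::
  "('k::field, 'c::ab_group_add) coalgebra \<Rightarrow> ('k, 'd::ab_group_add) vspace
    \<Rightarrow> ('k, 'c, 'd) comodule \<Rightarrow> ('k, 'c, 'd) comodule" where
  "subcomod C V F = \<lparr>carr = carr V, smul = smul V,
    coact = (\<lambda>t. THE z. z \<in> carr (tensor_space C V) \<and>
      tensor_map C V C F (\<lambda>a. a) (\<lambda>y. y) z = coact F t)\<rparr>"

lemma carr_subcomod [simp]: "carr (subcomod C V F) = carr V"
  and smul_subcomod [simp]: "smul (subcomod C V F) = smul V"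
  by (simp_all add: subcomod_def)

lemma tensor_map_retraction:
  assumes sub: "carr V \<subseteq> carr W" "smul V = smul W"
    and \<pi>: "k_linear W V \<pi>" "\<And>x. x \<in> carr V \<Longrightarrow> \<pi> x = x"
    and z: "z \<in> carr (tensor_space C V)"
  shows "tensor_map C W C V (\<lambda>a. a) \<pi> (tensor_map C V C W (\<lambda>a. a) (\<lambda>x. x) z) = z"
proof -
  note i = k_linear_inclusion[OF sub]
  have "tensor_map C W C V (\<lambda>a. a) \<pi> (tensor_map C V C W (\<lambda>a. a) (\<lambda>x. x) z) =
      tensor_map C V C V (\<lambda>a. a) (\<lambda>x. \<pi> x) z"
    by (rule tensor_map_compose[OF k_linear_ident i k_linear_ident \<pi>(1) z])
  also have "\<dots> = z"
    by (rule tensor_map_ident[OF z k_linear_compose[OF i \<pi>(1)] \<pi>(2)])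
  finally show ?thesis .
qed

text \<open>A linear retraction of the inclusion stays a retraction after tensoring with
  \<open>C\<close>. Injectivity allows equations in C \<otimes> V to be checked in C \<otimes>
  W.\<close>

lemma inj_on_tensor_map_inclusion:
  assumes V: "is_vspace V" "is_vspace W" and sub: "carr V \<subseteq> carr W" "smul V = smul W"
  shows "inj_on (tensor_map C V C W (\<lambda>a. a) (\<lambda>x. x)) (carr (tensor_space C V))"
proof -
  obtain \<pi> where \<pi>: "k_linear W V \<pi>" "\<And>x. x \<in> carr V \<Longrightarrow> \<pi> x = x"
    using ex_linear_retraction[OF V sub] by blast
  show ?thesis
    by (rule inj_on_inverseI[of _ "tensor_map C W C V (\<lambda>a. a) \<pi>"])
      (rule tensor_map_retraction[OF sub \<pi>])
qed

text \<open>The coaction of \<open>E\<close> is that of \<open>F\<close> followed by id \<otimes>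
  \<pi> for a retraction \<pi>, hence linear. Coassociativity is pulled back from \<open>F\<close>
  along \<pi>; the counit law is checked after inclusion into \<open>F\<close>.\<close>

lemma is_subcomoduleI:
  fixes C :: "('k::field, 'c::ab_group_add) coalgebra"
    and E F :: "('k, 'c, 'd::ab_group_add) comodule"
  assumes C: "is_coalgebra C" and F: "is_comodule C F" and E: "is_vspace E"
    and sub: "carr E \<subseteq> carr F" "smul E = smul F"
    and co: "\<And>t. t \<in> carr E \<Longrightarrow> coact E t \<in> carr (tensor_space C E)"
      "\<And>t. t \<in> carr E \<Longrightarrow> tensor_map C E C F (\<lambda>a. a) (\<lambda>y. y) (coact E t) = coact F t"
  shows "is_subcomodule C E F"
proof -
  note vF = is_vspace_comodule[OF F] and vC = is_vspace_coalgebra[OF C]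
  note i = k_linear_inclusion[OF sub]
  obtain \<pi> where \<pi>: "k_linear F E \<pi>" "\<And>x. x \<in> carr E \<Longrightarrow> \<pi> x = x"
    using ex_linear_retraction[OF E vF sub] by blast
  let ?r = "tensor_map C F C E (\<lambda>a. a) \<pi>"
  note r = k_linear_tensor_map[OF k_linear_ident[of C] \<pi>(1)]
  have coE: "?r (coact F t) = coact E t" if "t \<in> carr E" for t
    using tensor_map_retraction[OF sub \<pi> co(1)[OF that]] co(2)[OF that] by simp
  have "k_linear E (tensor_space C E) (\<lambda>t. ?r (coact F t))"
    by (rule k_linear_compose[OF k_linear_compose[OF i k_linear_coact[OF F]] r])
  also have "k_linear E (tensor_space C E) (\<lambda>t. ?r (coact F t)) \<longleftrightarrow>
      k_linear E (tensor_space C E) (coact E)"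
    by (rule k_linear_cong[OF E]) (rule coE)
  finally have lin: "k_linear E (tensor_space C E) (coact E)" .
  have evalF: "coact F t \<gamma> = coact E t \<gamma>" if "t \<in> carr E" "k_bilinear C F base_field \<gamma>" for t \<gamma>
    using tensor_map_eval[OF k_linear_ident i that(2) co(1)[OF that(1)]] co(2)[OF that(1)] by simp
  have inF: "coact F t \<in> carr (tensor_space C F)" if "t \<in> carr E" for t
    using that sub(1) k_linear_in[OF k_linear_coact[OF F]] by blast
  have evalE: "coact E t \<gamma> = coact F t (\<lambda>c x. \<gamma> c (\<pi> x))"
    if "t \<in> carr E" "k_bilinear C E base_field \<gamma>" for t \<gamma>
    using tensor_map_eval[OF k_linear_ident \<pi>(1) that(2) inF[OF that(1)]] coE[OF that(1)] by simp
  have "coassoc_at C E (coact E) t" if t: "t \<in> carr E" for t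
    unfolding coassoc_at_def
  proof (intro allI impI)
    fix \<beta> assume \<beta>: "k_bilinear C (tensor_space C E) base_field \<beta>"
    \<comment> \<open>Coassociativity of \<open>F\<close> is used at the form obtained by retracting
      the second argument to C \<otimes> E.\<close>
    have \<beta>': "k_bilinear C (tensor_space C F) base_field (\<lambda>a s. \<beta> a (?r s))"
      by (rule k_bilinear_compose[OF \<beta> k_linear_ident r])
    have tF: "t \<in> carr F"
      using t sub(1) by blast
    have "coact E t (\<lambda>c d. comult C c (\<lambda>a b. \<beta> a (tens C E b d))) =
        coact F t (\<lambda>c x. comult C c (\<lambda>a b. \<beta> a (tens C E b (\<pi> x))))"
      by (rule evalE[OF t k_bilinear_comult_eval[OF vC k_linear_comult[OF C] E \<beta>]])
    also have "\<dots> = coact F t (\<lambda>c x. comult C c (\<lambda>a b. \<beta> a (?r (tens C F b x))))"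
      by (intro tensor_eval_cong[OF vC vF inF[OF t]] tensor_eval_cong[OF vC vC k_linear_in[OF k_linear_comult[OF C]]])
        (simp_all add: tensor_map_tens[OF k_linear_ident \<pi>(1)])
    also have "\<dots> = coact F t (\<lambda>a x. \<beta> a (?r (coact F x)))"
      using F tF by (intro coassoc_atD[OF _ \<beta>']) (simp add: is_comodule_iff[OF C])
    \<comment> \<open>The outer evaluation moves back to \<open>E\<close>, so that x ranges over
      \<open>E\<close> and \<open>coE\<close> can replace the inner coaction.\<close>
    also have "\<dots> = coact E t (\<lambda>a x. \<beta> a (?r (coact F x)))"
      by (rule evalF[OF t k_bilinear_compose[OF \<beta>' k_linear_ident k_linear_coact[OF F]]])
    also have "\<dots> = coact E t (\<lambda>a d. \<beta> a (coact E d))"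
      by (rule tensor_eval_cong[OF vC E co(1)[OF t]]) (simp add: coE)
    finally show "coact E t (\<lambda>c d. comult C c (\<lambda>a b. \<beta> a (tens C E b d))) =
        coact E t (\<lambda>a d. \<beta> a (coact E d))" .
  qed
  moreover have "tensor_lift C E E (\<lambda>a z. smul E (counit C a) z) (coact E t) = t" if t: "t \<in> carr E" for t
  proof -
    have "tensor_lift C E E (\<lambda>a z. smul E (counit C a) z) (coact E t) =
        tensor_lift C E F (\<lambda>a z. smul E (counit C a) z) (coact E t)"
      by (rule k_linear_tensor_lift_commute[OF E vF k_bilinear_smul[OF E k_linear_counit[OF C] k_linear_ident]
            i co(1)[OF t]])
    also have "\<dots> = tensor_lift C F F (\<lambda>a z. smul F (counit C a) z) (tensor_map C E C F (\<lambda>a. a) (\<lambda>y. y) (coact E t))"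
      unfolding sub(2)
      by (rule tensor_lift_tensor_map[OF k_linear_ident i vF
            k_bilinear_smul[OF vF k_linear_counit[OF C] k_linear_ident] co(1)[OF t], symmetric])
    also have "\<dots> = t"
      using t sub(1) by (simp add: co(2) coact_counit[OF F] subsetD)
    finally show ?thesis .
  qed
  ultimately have "is_comodule C E"
    using E lin by (simp add: is_comodule_iff[OF C])
  then show ?thesis
    using sub i co(2) by (simp add: is_subcomodule_def comodule_morphism_def)
qed

lemma is_subcomodule_subcomod:
  fixes C :: "('k::field, 'c::ab_group_add) coalgebra"
  assumes C: "is_coalgebra C" and F: "is_comodule C F" and V: "is_vspace V"
    and sub: "carr V \<subseteq> carr F" "smul V = smul F"
    and ex: "\<And>t. t \<in> carr V \<Longrightarrow> \<exists>z\<in>carr (tensor_space C V). tensor_map C V C F (\<lambda>a. a) (\<lambda>y. y) z = coact F t"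
  shows "is_subcomodule C (subcomod C V F) F"
proof (rule is_subcomoduleI[OF C F])
  note cong = carr_subcomod[of C V F] smul_subcomod[of C V F]
  note inj = inj_on_tensor_map_inclusion[OF V is_vspace_comodule[OF F] sub]
  show "is_vspace (subcomod C V F)" "carr (subcomod C V F) \<subseteq> carr F" "smul (subcomod C V F) = smul F"
    using V sub by (simp_all add: is_vspace_carr_smul_cong[OF cong])
  fix t assume "t \<in> carr (subcomod C V F)"
  \<comment> \<open>Existence is the hypothesis \<open>ex\<close> and uniqueness is injectivity, so
    the definite description in \<open>subcomod\<close> denotes.\<close>
  then have "\<exists>!z. z \<in> carr (tensor_space C V) \<and> tensor_map C V C F (\<lambda>a. a) (\<lambda>y. y) z = coact F t"
    using ex[of t] inj by (metis inj_onD carr_subcomod)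
  from theI'[OF this]
  show "coact (subcomod C V F) t \<in> carr (tensor_space C (subcomod C V F))"
    "tensor_map C (subcomod C V F) C F (\<lambda>a. a) (\<lambda>y. y) (coact (subcomod C V F) t) = coact F t"
    unfolding tensor_space_carr_smul_cong[OF cong] tensor_map_carr_smul_cong[OF cong]
    by (simp_all add: subcomod_def)
qed

lemma
  assumes "is_subcomodule C E F"
  shows is_comodule_subcomodule: "is_comodule C E"
    and carr_subcomodule: "carr E \<subseteq> carr F"
    and smul_subcomodule: "smul E = smul F"
    and comodule_morphism_subcomodule: "comodule_morphism C E F (\<lambda>y. y)"
  using assms by (simp_all add: is_subcomodule_def)

text \<open>The equation is compared after the injective map C \<otimes> E \<rightarrow> C \<otimes>
  F, where both sides become the coaction of \<open>F\<close> at \<chi> y.\<close>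

lemma comodule_morphism_into_subcomodule:
  fixes C :: "('k::field, 'c::ab_group_add) coalgebra"
  assumes C: "is_coalgebra C" and D: "is_comodule C D" and F: "is_comodule C F"
    and E: "is_subcomodule C E F"
    and \<chi>: "comodule_morphism C D F \<chi>" "\<chi> ` carr D \<subseteq> carr E"
  shows "comodule_morphism C D E \<chi>"
proof -
  note i = k_linear_comodule_morphism[OF comodule_morphism_subcomodule[OF E]]
  note vE = is_vspace_comodule[OF is_comodule_subcomodule[OF E]]
  have lin: "k_linear D E \<chi>"
    using k_linear_comodule_morphism[OF \<chi>(1)] \<chi>(2) by (auto simp: k_linear_def smul_subcomodule[OF E])
  have "coact E (\<chi> y) = tensor_map C D C E (\<lambda>a. a) \<chi> (coact D y)" if y: "y \<in> carr D" for y
  proof (rule inj_onD[OF inj_on_tensor_map_inclusion[OF vE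
          is_vspace_comodule[OF F] carr_subcomodule[OF E] smul_subcomodule[OF E]]])
    note coy = k_linear_in[OF k_linear_coact[OF D] y]
    have \<chi>y: "\<chi> y \<in> carr E"
      using \<chi>(2) y by blast
    show "coact E (\<chi> y) \<in> carr (tensor_space C E)"
      by (rule k_linear_in[OF k_linear_coact[OF is_comodule_subcomodule[OF E]] \<chi>y])
    show "tensor_map C D C E (\<lambda>a. a) \<chi> (coact D y) \<in> carr (tensor_space C E)"
      by (rule k_linear_in[OF k_linear_tensor_map[OF k_linear_ident lin] coy])
    show "tensor_map C E C F (\<lambda>a. a) (\<lambda>x. x) (coact E (\<chi> y)) =
        tensor_map C E C F (\<lambda>a. a) (\<lambda>x. x) (tensor_map C D C E (\<lambda>a. a) \<chi> (coact D y))"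
      using tensor_map_compose[OF k_linear_ident lin k_linear_ident i coy]
        comodule_morphism_coact[OF comodule_morphism_subcomodule[OF E] \<chi>y]
        comodule_morphism_coact[OF \<chi>(1) y] by simp
  qed
  with lin show ?thesis
    by (simp add: comodule_morphism_def)
qed

text \<open>Since \<chi> is a morphism, the coaction of \<chi> y is the image of that of y under id
  \<otimes> \<chi>, which comes from C \<otimes> \<chi>(D).\<close>

lemma subcomodule_image:
  fixes C :: "('k::field, 'c::ab_group_add) coalgebra"
  assumes C: "is_coalgebra C" and D: "is_comodule C D" and F: "is_comodule C F"
    and \<chi>: "comodule_morphism C D F \<chi>"
  obtains E where "is_subcomodule C E F" "carr E = \<chi> ` carr D"
proof -
  note vF = is_vspace_comodule[OF F] and vD = is_vspace_comodule[OF D]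
  define V where "V = \<lparr>carr = \<chi> ` carr D, smul = smul F\<rparr>"
  note lin = k_linear_comodule_morphism[OF \<chi>]
  interpret F: vector_space "smul F"
    using vF by (simp add: is_vspace_def)
  have "F.subspace (\<chi> ` carr D)"
    unfolding F.subspace_def
  proof (intro conjI ballI allI)
    show "0 \<in> \<chi> ` carr D"
      using k_linear_scale[OF lin is_vspace_zero[OF vD], of 0] is_vspace_zero[OF vD]
      by (metis F.scale_zero_left imageI smul_zero_left[OF vD])
    show "x + y \<in> \<chi> ` carr D" if "x \<in> \<chi> ` carr D" "y \<in> \<chi> ` carr D" for x y
      using that by (auto simp: k_linear_add[OF lin, symmetric] is_vspace_add[OF vD])
    show "smul F a x \<in> \<chi> ` carr D" if "x \<in> \<chi> ` carr D" for a x
      using that by (auto simp: k_linear_scale[OF lin, symmetric] is_vspace_scale[OF vD])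
  qed
  then have V: "is_vspace V"
    by (simp add: is_vspace_def V_def F.vector_space_axioms)
  have sub: "carr V \<subseteq> carr F" "smul V = smul F"
    using k_linear_in[OF lin] by (auto simp: V_def)
  have \<chi>V: "k_linear D V \<chi>"
    using lin by (auto simp: V_def k_linear_def)
  have "is_subcomodule C (subcomod C V F) F"
  proof (rule is_subcomodule_subcomod[OF C F V sub])
    fix t assume "t \<in> carr V"
    then obtain y where y: "y \<in> carr D" "t = \<chi> y"
      by (auto simp: V_def)
    note coy = k_linear_in[OF k_linear_coact[OF D] y(1)]
    have "tensor_map C V C F (\<lambda>a. a) (\<lambda>y. y) (tensor_map C D C V (\<lambda>a. a) \<chi> (coact D y)) = coact F t"
      using tensor_map_compose[OF k_linear_ident \<chi>V k_linear_ident k_linear_inclusion[OF sub] coy]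
        comodule_morphism_coact[OF \<chi> y(1)] y(2) by simp
    then show "\<exists>z\<in>carr (tensor_space C V). tensor_map C V C F (\<lambda>a. a) (\<lambda>y. y) z = coact F t"
      using k_linear_in[OF k_linear_tensor_map[OF k_linear_ident \<chi>V] coy] by blast
  qed
  then show ?thesis
    by (rule that) (simp add: V_def)
qed

text \<open>The elements of \<open>F\<close> whose coaction comes from C \<otimes> V form a subspace
  containing every member of the family, hence the span.\<close>

lemma is_subcomodule_span:
  fixes C :: "('k::field, 'c::ab_group_add) coalgebra"
  assumes C: "is_coalgebra C" and F: "is_comodule C F"
    and \<E>: "\<And>E. E \<in> \<E> \<Longrightarrow> is_subcomodule C E F"
  shows "is_subcomodule C (subcomod C \<lparr>carr = module.span (smul F) (\<Union>(carr ` \<E>)), smul = smul F\<rparr> F) F"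
proof -
  note vF = is_vspace_comodule[OF F]
  interpret F: vector_space "smul F"
    using vF by (simp add: is_vspace_def)
  let ?S = "\<Union>(carr ` \<E>)"
  define V where "V = \<lparr>carr = F.span ?S, smul = smul F\<rparr>"
  have V: "is_vspace V"
    by (simp add: is_vspace_def V_def F.vector_space_axioms)
  have "?S \<subseteq> carr F"
    using carr_subcomodule[OF \<E>] by blast
  then have sub: "carr V \<subseteq> carr F" "smul V = smul F"
    using F.span_minimal[of ?S "carr F"] vF by (auto simp: V_def is_vspace_def)
  let ?i = "tensor_map C V C F (\<lambda>a. a) (\<lambda>y. y)" and ?T = "tensor_space C V"
  note i = k_linear_tensor_map[OF k_linear_ident[of C] k_linear_inclusion[OF sub]]
  note T = is_vspace_tensor_space[of C V]
  note \<delta> = k_linear_coact[OF F]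
  \<comment> \<open>The witness is the coaction in a member \<open>E\<close> containing
    \<open>t\<close>, pushed along the inclusion of \<open>E\<close> into \<open>V\<close>.\<close>
  have gen: "\<exists>z\<in>carr ?T. ?i z = coact F t" if t: "t \<in> ?S" for t
  proof -
    from t obtain E where E: "E \<in> \<E>" "t \<in> carr E"
      by blast
    note Es = \<E>[OF E(1)]
    have EV: "k_linear E V (\<lambda>y. y)"
      using E(1) F.span_superset[of ?S] smul_subcomodule[OF Es]
      by (intro k_linear_inclusion) (auto simp: V_def)
    note coy = k_linear_in[OF k_linear_coact[OF is_comodule_subcomodule[OF Es]] E(2)]
    have "?i (tensor_map C E C V (\<lambda>a. a) (\<lambda>y. y) (coact E t)) = coact F t"
      using tensor_map_compose[OF k_linear_ident EV k_linear_ident k_linear_inclusion[OF sub] coy]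
        comodule_morphism_coact[OF comodule_morphism_subcomodule[OF Es] E(2)] by simp
    then show ?thesis
      using k_linear_in[OF k_linear_tensor_map[OF k_linear_ident EV] coy] by blast
  qed
  have "is_subcomodule C (subcomod C V F) F"
  proof (rule is_subcomodule_subcomod[OF C F V sub])
    fix t assume "t \<in> carr V"
    then have "t \<in> F.span ?S"
      by (simp add: V_def)
    then have "t \<in> carr F \<and> (\<exists>z\<in>carr ?T. ?i z = coact F t)"
    proof (induction rule: F.span_induct_alt)
      case base
      have "?i 0 = 0" "coact F 0 = 0"
        using k_linear_scale[OF i is_vspace_zero[OF T], of 0] k_linear_scale[OF \<delta> is_vspace_zero[OF vF], of 0]
        by (simp_all add: smul_zero_left[OF is_vspace_tensor_space] smul_zero_left[OF vF] del: smul_tensor_space)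
      then show ?case
        using is_vspace_zero[OF T] is_vspace_zero[OF vF] by (metis (no_types))
    next
      case (step c x y)
      then obtain z where z: "z \<in> carr ?T" "?i z = coact F y" and y: "y \<in> carr F"
        by blast
      obtain w where w: "w \<in> carr ?T" "?i w = coact F x"
        using gen[OF step(1)] by blast
      have x: "x \<in> carr F"
        using step(1) \<open>?S \<subseteq> carr F\<close> by blast
      have "?i (smul ?T c w + z) = coact F (smul F c x + y)"
        by (simp only: k_linear_add[OF i is_vspace_scale[OF T w(1)] z(1)] k_linear_scale[OF i w(1)] w z
            k_linear_add[OF \<delta> is_vspace_scale[OF vF x] y] k_linear_scale[OF \<delta> x])
      then show ?case
        using is_vspace_add[OF T is_vspace_scale[OF T w(1)] z(1)]
          is_vspace_add[OF vF is_vspace_scale[OF vF x] y] by blast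
    qed
    then show "\<exists>z\<in>carr ?T. ?i z = coact F t" ..
  qed
  then show ?thesis
    by (simp add: V_def)
qed

section \<open>The universal comodule measuring\<close>

lemma k_linear_Vect_apply:
  assumes "k_linear D (Vect V W) f" "l \<in> carr V"
  shows "k_linear D W (\<lambda>y. f y l)"
  using assms by (auto simp: k_linear_def Vect_def fun_eq_iff)

lemma is_vspace_hom_product:
  fixes L :: "('k::field, 'o, 'l::ab_group_add) comp_module"
    and L' :: "('k, 'p, 'm::ab_group_add) comp_module"
  assumes "\<And>n. is_vspace (lspace L' n)"
  shows "is_vspace (hom_product L L')"
proof -
  note simps = smul_add_right[OF assms] smul_add_left[OF assms] smul_smul[OF assms] smul_one[OF assms]
  let ?s = "smul (hom_product L L')"
  \<comment> \<open>Scalars act through the target in each degree, on all functions, so the laws can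
    be proved on the whole ambient type.\<close>
  have s: "?s a f = (\<lambda>n x. smul (lspace L' n) a (f n x))" for a f
    by (simp add: hom_product_def Vect_def)
  interpret vector_space ?s
    by unfold_locales (simp_all add: s fun_eq_iff simps)
  have "subspace (carr (hom_product L L'))"
    unfolding subspace_def s
    by (auto simp: hom_product_def Vect_def k_linear_def simps is_vspace_add[OF assms]
        is_vspace_zero[OF assms] is_vspace_scale[OF assms] smul_zero_right[OF assms] mult.commute
        add.assoc add.left_commute)
  then show ?thesis
    by (simp add: is_vspace_def vector_space_axioms)
qed

lemma k_linear_hom_product_component:
  "k_linear (hom_product L L') (Vect (lspace L n) (lspace L' n)) (\<lambda>f. f n)"
  by (simp add: k_linear_def hom_product_def)

lemma k_linear_hom_product:
  assumes "\<And>n. k_linear D (Vect (lspace L n) (lspace L' n)) (\<Omega> n)"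
  shows "k_linear D (hom_product L L') (\<lambda>y n. \<Omega> n y)"
  using assms by (auto simp: k_linear_def hom_product_def fun_eq_iff)

text \<open>The equations are isolated at one element so that they can be transported along a
  morphism and extended from generators to a span.\<close>

definition measures_at ::
  "('k::field, 'c::ab_group_add) coalgebra \<Rightarrow> ('k, 'o::ab_group_add) operad
    \<Rightarrow> (nat \<Rightarrow> 'c \<Rightarrow> 'o \<Rightarrow> 'p::ab_group_add)
    \<Rightarrow> ('k, 'o, 'l::ab_group_add) comp_module \<Rightarrow> ('k, 'p, 'm::ab_group_add) comp_module
    \<Rightarrow> ('k, 'c, 'd::ab_group_add) comodule \<Rightarrow> (nat \<Rightarrow> 'd \<Rightarrow> 'l \<Rightarrow> 'm) \<Rightarrow> 'd \<Rightarrow> bool" where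
  "measures_at C P \<Psi> L L' D \<Omega> y \<longleftrightarrow>
    (\<forall>p n i. \<forall>u\<in>carr (ospace P p). \<forall>l\<in>carr (lspace L n).
      p \<le> n + 1 \<and> i \<le> n + 1 - p \<longrightarrow>
      \<Omega> (n + 1 - p) y (lact L p n i u l) =
        tensor_lift C D (lspace L' (n + 1 - p))
          (\<lambda>y\<^sub>0 y\<^sub>1. lact L' p n i (\<Psi> p y\<^sub>0 u) (\<Omega> n y\<^sub>1 l)) (coact D y)) \<and>
    (\<forall>n. \<forall>l\<in>carr (lspace L n). \<Omega> n y (lcyc L n l) = lcyc L' n (\<Omega> n y l))"

lemma is_comodule_measuring_iff:
  "is_comodule_measuring C P \<Psi> L L' D \<Omega> \<longleftrightarrow> is_comodule C D \<and>
    (\<forall>n. k_linear D (Vect (lspace L n) (lspace L' n)) (\<Omega> n)) \<and>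
    (\<forall>y\<in>carr D. measures_at C P \<Psi> L L' D \<Omega> y)"
  unfolding is_comodule_measuring_def measures_at_def by blast

lemma
  assumes "is_cyclic_comp_module P L"
  shows is_vspace_lspace: "is_vspace (lspace L n)"
    and k_linear_lcyc: "k_linear (lspace L n) (lspace L n) (lcyc L n)"
  using assms by (simp_all add: is_cyclic_comp_module_def)

lemma k_bilinear_lact:
  assumes "is_cyclic_comp_module P L" "p \<le> n + 1" "i \<le> n + 1 - p"
  shows "k_bilinear (ospace P p) (lspace L n) (lspace L (n + 1 - p)) (lact L p n i)"
proof -
  have "\<forall>p n i. p \<le> n + 1 \<and> i \<le> n + 1 - p \<longrightarrow>
      k_bilinear (ospace P p) (lspace L n) (lspace L (n + 1 - p)) (lact L p n i)"
    using assms(1) unfolding is_cyclic_comp_module_def by (elim conjE)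
  with assms(2,3) show ?thesis by blast
qed

section \<open>Transport and linearity of the measuring equations\<close>

context
  fixes C :: "('k::field, 'c::ab_group_add) coalgebra"
    and P :: "('k, 'o::ab_group_add) operad"
    and P' :: "('k, 'p::ab_group_add) operad"
    and \<Psi> :: "nat \<Rightarrow> 'c \<Rightarrow> 'o \<Rightarrow> 'p"
    and L :: "('k, 'o, 'l::ab_group_add) comp_module"
    and L' :: "('k, 'p, 'm::ab_group_add) comp_module"
  assumes C: "is_coalgebra C"
    and \<Psi>: "is_measuring C P P' \<Psi>"
    and L: "is_cyclic_comp_module P L" and L': "is_cyclic_comp_module P' L'"
begin

text \<open>Ensures that the Sweedler sum in the measuring equation is a genuine lift.\<close>

lemma k_bilinear_measuring_lact:
  assumes \<omega>: "k_linear D (Vect (lspace L n) (lspace L' n)) (\<omega>)"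
    and pi: "p \<le> n + 1" "i \<le> n + 1 - p" and ul: "u \<in> carr (ospace P p)" "l \<in> carr (lspace L n)"
  shows "k_bilinear C D (lspace L' (n + 1 - p)) (\<lambda>y\<^sub>0 y\<^sub>1. lact L' p n i (\<Psi> p y\<^sub>0 u) (\<omega> y\<^sub>1 l))"
proof -
  have "k_linear C (Vect (ospace P p) (ospace P' p)) (\<Psi> p)"
    using \<Psi> by (simp add: is_measuring_def)
  then show ?thesis
    by (rule k_bilinear_compose[OF k_bilinear_lact[OF L' pi] k_linear_Vect_apply[OF _ ul(1)] k_linear_Vect_apply[OF \<omega> ul(2)]])
qed

text \<open>The equation at \<open>y\<close> sees the comodule only through its coaction and
  \<Omega>; the first is preserved by \<chi> and the second is \<Theta> composed with
  \<chi>.\<close>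

lemma measures_at_morphism:
  assumes D: "is_comodule C D" and E: "is_comodule C E" and \<chi>: "comodule_morphism C D E \<chi>"
    and \<Theta>: "\<And>n. k_linear E (Vect (lspace L n) (lspace L' n)) (\<Theta> n)"
    and eq: "\<And>n y. y \<in> carr D \<Longrightarrow> \<Theta> n (\<chi> y) = \<Omega> n y"
    and y: "y \<in> carr D" "measures_at C P \<Psi> L L' D \<Omega> y"
  shows "measures_at C P \<Psi> L L' E \<Theta> (\<chi> y)"
  unfolding measures_at_def
proof (intro conjI allI ballI impI)
  note coy = k_linear_in[OF k_linear_coact[OF D] y(1)]
  fix p n i u l
  assume ul: "u \<in> carr (ospace P p)" "l \<in> carr (lspace L n)" and "p \<le> n + 1 \<and> i \<le> n + 1 - p"
  then have pi: "p \<le> n + 1" "i \<le> n + 1 - p" by auto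
  let ?W = "lspace L' (n + 1 - p)"
  let ?h = "\<lambda>\<Omega> y\<^sub>0 y\<^sub>1. lact L' p n i (\<Psi> p y\<^sub>0 u) (\<Omega> n y\<^sub>1 l)"
  have "\<Theta> (n + 1 - p) (\<chi> y) (lact L p n i u l) = tensor_lift C D ?W (?h \<Omega>) (coact D y)"
    using y(2) ul pi by (simp add: measures_at_def eq[OF y(1)])
  also have "\<dots> = tensor_lift C D ?W (\<lambda>y\<^sub>0 y\<^sub>1. ?h \<Theta> y\<^sub>0 (\<chi> y\<^sub>1)) (coact D y)"
    by (rule fun_cong[OF tensor_lift_cong[OF is_vspace_coalgebra[OF C] is_vspace_comodule[OF D]]])
      (simp add: eq)
  \<comment> \<open>Here \<chi> passes from the bilinear map to the tensor, where the morphism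
    property turns it into the coaction at \<chi> y.\<close>
  also have "\<dots> = tensor_lift C E ?W (?h \<Theta>) (tensor_map C D C E (\<lambda>a. a) \<chi> (coact D y))"
    by (rule tensor_lift_tensor_map[OF k_linear_ident k_linear_comodule_morphism[OF \<chi>] is_vspace_lspace[OF L']
          k_bilinear_measuring_lact[OF \<Theta> pi ul] coy, symmetric])
  finally show "\<Theta> (n + 1 - p) (\<chi> y) (lact L p n i u l) = tensor_lift C E ?W (?h \<Theta>) (coact E (\<chi> y))"
    by (simp add: comodule_morphism_coact[OF \<chi> y(1)])
next
  show "\<Theta> n (\<chi> y) (lcyc L n l) = lcyc L' n (\<Theta> n (\<chi> y) l)" if "l \<in> carr (lspace L n)" for n l
    using y(2) that by (simp add: measures_at_def eq[OF y(1)])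
qed

text \<open>For fixed \<open>u\<close> and \<open>l\<close> both sides of each equation are linear
  in \<open>y\<close>; the Sweedler side is the coaction followed by a lift.\<close>

lemma measures_at_span:
  assumes E: "is_comodule C E"
    and \<Theta>: "\<And>n. k_linear E (Vect (lspace L n) (lspace L' n)) (\<Theta> n)"
    and S: "S \<subseteq> carr E" "\<And>x. x \<in> S \<Longrightarrow> measures_at C P \<Psi> L L' E \<Theta> x"
    and y: "y \<in> module.span (smul E) S"
  shows "measures_at C P \<Psi> L L' E \<Theta> y"
  unfolding measures_at_def
proof (intro conjI allI ballI impI)
  fix p n i u l
  assume ul: "u \<in> carr (ospace P p)" "l \<in> carr (lspace L n)" and "p \<le> n + 1 \<and> i \<le> n + 1 - p"
  then have pi: "p \<le> n + 1" "i \<le> n + 1 - p" by auto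
  show "\<Theta> (n + 1 - p) y (lact L p n i u l) = tensor_lift C E (lspace L' (n + 1 - p))
      (\<lambda>y\<^sub>0 y\<^sub>1. lact L' p n i (\<Psi> p y\<^sub>0 u) (\<Theta> n y\<^sub>1 l)) (coact E y)"
  proof (rule k_linear_eq_on_span[OF is_vspace_comodule[OF E] is_vspace_lspace[OF L']
        k_linear_Vect_apply[OF \<Theta> k_linear_in[OF k_bilinear_right[OF k_bilinear_lact[OF L pi] ul(1)] ul(2)]]
        k_linear_compose[OF k_linear_coact[OF E] k_linear_tensor_lift[OF is_vspace_lspace[OF L'] k_bilinear_measuring_lact[OF \<Theta> pi ul]]]
        S(1) _ y])
    show "\<Theta> (n + 1 - p) x (lact L p n i u l) = tensor_lift C E (lspace L' (n + 1 - p))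
      (\<lambda>y\<^sub>0 y\<^sub>1. lact L' p n i (\<Psi> p y\<^sub>0 u) (\<Theta> n y\<^sub>1 l)) (coact E x)" if "x \<in> S" for x
      using S(2)[OF that] ul pi unfolding measures_at_def by blast
  qed
next
  fix n l assume l: "l \<in> carr (lspace L n)"
  show "\<Theta> n y (lcyc L n l) = lcyc L' n (\<Theta> n y l)"
  proof (rule k_linear_eq_on_span[OF is_vspace_comodule[OF E] is_vspace_lspace[OF L']
        k_linear_Vect_apply[OF \<Theta> k_linear_in[OF k_linear_lcyc[OF L] l]]
        k_linear_compose[OF k_linear_Vect_apply[OF \<Theta> l] k_linear_lcyc[OF L']] S(1) _ y])
    show "\<Theta> n x (lcyc L n l) = lcyc L' n (\<Theta> n x l)" if "x \<in> S" for x
      using S(2)[OF that] l unfolding measures_at_def by blast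
  qed
qed

section \<open>The sum of all measuring subcomodules and its universal property\<close>

private abbreviation (input) "Hom \<equiv> hom_product L L'"
private abbreviation (input) "F \<equiv> cofree_comodule C Hom"
private abbreviation (input) "Q \<equiv> univ_comodule C P \<Psi> L L'"
private abbreviation (input) "\<Theta> \<equiv> univ_measuring C L L'"
private abbreviation (input) "measuring_subcomodules \<equiv>
  {E. is_subcomodule C E F \<and> is_comodule_measuring C P \<Psi> L L' E \<Theta>}"

lemma vHom: "is_vspace Hom"
  using is_vspace_lspace[OF L'] by (rule is_vspace_hom_product)

text \<open>Stated for any subspace of the cofree comodule, as it serves both the universal comodule
  and the image of a given measuring comodule.\<close>

lemma k_linear_univ_measuring:
  assumes "carr E \<subseteq> carr F" "smul E = smul F"
  shows "k_linear E (Vect (lspace L n) (lspace L' n)) (\<Theta> n)"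
proof -
  have "k_linear F (Vect (lspace L n) (lspace L' n)) (\<Theta> n)"
    unfolding univ_measuring_def
    by (rule k_linear_compose[OF k_linear_cofree_proj[OF C vHom] k_linear_hom_product_component])
  from k_linear_compose[OF k_linear_inclusion[OF assms] this] show ?thesis .
qed

lemma univ_comodule_eq:
  "Q = subcomod C \<lparr>carr = module.span (smul F) (\<Union>(carr ` measuring_subcomodules)), smul = smul F\<rparr> F"
  by (simp add: univ_comodule_def univ_space_def subcomod_def Let_def setcompr_eq_image)

lemma carr_univ_comodule: "carr Q = module.span (smul F) (\<Union>(carr ` measuring_subcomodules))"
  by (simp add: univ_comodule_eq)

lemma is_subcomodule_univ: "is_subcomodule C Q F"
  unfolding univ_comodule_eq using C is_comodule_cofree[OF C vHom] by (rule is_subcomodule_span) simp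

lemma measuring_subcomodule_subset:
  assumes "E \<in> measuring_subcomodules"
  shows "carr E \<subseteq> carr Q"
proof -
  interpret vector_space "smul F"
    using is_vspace_comodule[OF is_comodule_cofree[OF C vHom]] by (simp add: is_vspace_def)
  show ?thesis
    unfolding carr_univ_comodule using assms by (rule order_trans[OF UN_upper span_superset])
qed

lemma is_comodule_measuring_univ: "is_comodule_measuring C P \<Psi> L L' Q \<Theta>"
  unfolding is_comodule_measuring_iff
proof (intro conjI allI ballI)
  note Q = is_subcomodule_univ
  show co: "is_comodule C Q"
    by (rule is_comodule_subcomodule[OF Q])
  show lin: "k_linear Q (Vect (lspace L n) (lspace L' n)) (\<Theta> n)" for n
    by (rule k_linear_univ_measuring[OF carr_subcomodule[OF Q] smul_subcomodule[OF Q]])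
  fix y assume "y \<in> carr Q"
  then have y: "y \<in> module.span (smul Q) (\<Union>(carr ` measuring_subcomodules))"
    unfolding smul_subcomodule[OF Q] carr_univ_comodule .
  show "measures_at C P \<Psi> L L' Q \<Theta> y"
  proof (rule measures_at_span[OF co lin _ _ y])
    show "\<Union>(carr ` measuring_subcomodules) \<subseteq> carr Q"
      using measuring_subcomodule_subset by (rule UN_least)
    fix x assume "x \<in> \<Union>(carr ` measuring_subcomodules)"
    then obtain E where E: "E \<in> measuring_subcomodules" and x: "x \<in> carr E"
      by (rule UN_E)
    then have sub: "is_subcomodule C E F" and meas: "is_comodule_measuring C P \<Psi> L L' E \<Theta>"
      by auto
    note coE = is_comodule_subcomodule[OF sub]
    \<comment> \<open>The inclusion of a summand into the sum is a morphism, along which the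
      equations at x are transported with the same maps \<Theta> on both sides.\<close>
    have "comodule_morphism C E Q (\<lambda>y. y)"
      using measuring_subcomodule_subset[OF E]
      by (intro comodule_morphism_into_subcomodule[OF C coE is_comodule_cofree[OF C vHom] Q
            comodule_morphism_subcomodule[OF sub]]) simp
    from measures_at_morphism[OF coE co this lin refl x] show "measures_at C P \<Psi> L L' Q \<Theta> x"
      using meas x by (simp add: is_comodule_measuring_iff)
  qed
qed

text \<open>The map into the cofree comodule induced by the family \<Omega> has its image among the
  summands of \<open>Q\<close>, so it corestricts to \<open>Q\<close>.\<close>

lemma comodule_measuring_factors:
  assumes \<Omega>: "is_comodule_measuring C P \<Psi> L L' D \<Omega>"
  shows "\<exists>\<chi>. comodule_morphism C D Q \<chi> \<and> (\<forall>n. \<forall>y\<in>carr D. \<Theta> n (\<chi> y) = \<Omega> n y)"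
proof -
  have D: "is_comodule C D" and lin: "\<And>n. k_linear D (Vect (lspace L n) (lspace L' n)) (\<Omega> n)"
    and meas: "\<And>y. y \<in> carr D \<Longrightarrow> measures_at C P \<Psi> L L' D \<Omega> y"
    using \<Omega> by (auto simp: is_comodule_measuring_iff)
  note F = is_comodule_cofree[OF C vHom]
  note f = k_linear_hom_product[OF lin]
  define \<chi> where "\<chi> = (\<lambda>y. tensor_map C D C Hom (\<lambda>a. a) (\<lambda>y n. \<Omega> n y) (coact D y))"
  have \<chi>: "comodule_morphism C D F \<chi>"
    unfolding \<chi>_def by (rule comodule_morphism_cofree_map[OF C vHom D f])
  have eq: "\<Theta> n (\<chi> y) = \<Omega> n y" if "y \<in> carr D" for n y
    by (simp add: univ_measuring_def \<chi>_def cofree_proj_cofree_map[OF C vHom D f that])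
  obtain E where E: "is_subcomodule C E F" "carr E = \<chi> ` carr D"
    using subcomodule_image[OF C D F \<chi>] .
  note coE = is_comodule_subcomodule[OF E(1)]
  note linE = k_linear_univ_measuring[OF carr_subcomodule[OF E(1)] smul_subcomodule[OF E(1)]]
  have \<chi>E: "comodule_morphism C D E \<chi>"
    by (rule comodule_morphism_into_subcomodule[OF C D F E(1) \<chi>]) (simp add: E(2))
  \<comment> \<open>Every element of the image has the form \<chi> y, and the equations there come
    from those for \<Omega> at y.\<close>
  have "measures_at C P \<Psi> L L' E \<Theta> (\<chi> y)" if "y \<in> carr D" for y
    by (rule measures_at_morphism[OF D coE \<chi>E linE _ that meas[OF that]]) (rule eq)
  then have "is_comodule_measuring C P \<Psi> L L' E \<Theta>"
    using coE linE by (auto simp: is_comodule_measuring_iff E(2))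
  then have "\<chi> ` carr D \<subseteq> carr Q"
    using measuring_subcomodule_subset[of E] E by simp
  from comodule_morphism_into_subcomodule[OF C D F is_subcomodule_univ \<chi> this] eq
  show ?thesis
    by blast
qed

end

theorem proposition8p6:
  fixes C :: "('k::field, 'c::ab_group_add) coalgebra"
    and P :: "('k, 'o::ab_group_add) operad"
    and P' :: "('k, 'p::ab_group_add) operad"
    and \<Psi> :: "nat \<Rightarrow> 'c \<Rightarrow> 'o \<Rightarrow> 'p"
    and L :: "('k, 'o, 'l::ab_group_add) comp_module"
    and L' :: "('k, 'p, 'm::ab_group_add) comp_module"
  assumes "is_coalgebra C" and "is_cocommutative C"
    and "is_operad_with_mult P" and "is_operad_with_mult P'"
    and "is_measuring C P P' \<Psi>"
    and "is_cyclic_comp_module P L" and "is_cyclic_comp_module P' L'"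
  shows "is_comodule_measuring C P \<Psi> L L' (univ_comodule C P \<Psi> L L') (univ_measuring C L L') \<and>
    (\<forall>(D :: ('k, 'c, 'd::ab_group_add) comodule) \<Omega>.
      is_comodule_measuring C P \<Psi> L L' D \<Omega> \<longrightarrow>
      (\<exists>\<chi>. comodule_morphism C D (univ_comodule C P \<Psi> L L') \<chi> \<and>
        (\<forall>n. \<forall>y\<in>carr D. univ_measuring C L L' n (\<chi> y) = \<Omega> n y)))"
  using is_comodule_measuring_univ[OF assms(1,5,6,7)] comodule_measuring_factors[OF assms(1,5,6,7)]
  by blast

end
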